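(* Let $K$ be a field, let $S$ be either $K[[x_1,\ldots,x_n]]$ or $K[x_1,\ldots,x_n]$, let $I,J\subset S$ be ideals (graded if $S$ is the polynomial ring), and let $\sigma$ be a permutation of $\{1,\ldots,n\}$. Then the following hold: (a) If $I$ and $J$ are $d_\sigma$-Golod, then $I\cap J$ and $IJ$ are $d_\sigma$-Golod. (b) If $I$ and $J$ are $d_\sigma$-Golod and $d_\sigma(I)d_\sigma(J)\subset I+J$, then $I+J$ is $d_\sigma$-Golod. (c) If $I$ is a strongly $d$-Golod monomial ideal and $J$ is an arbitrary monomial ideal such that $I:J=I:J^2$, then $I:J$ is strongly $d$-Golod (provided $I:J$ is a proper ideal). (d) If $I$ is a monomial ideal, then for all $k\ge2$ each of the ideals $I^k$, $I^{(k)}$ and $\widetilde{I^k}$ is strongly $d$-Golod (provided it is a proper ideal). (e) If $I\subset J$ are monomial ideals and $I$ is $d_\sigma$-Golod, then $IJ$ is $d_\sigma$-Golod.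
   Context: $\mathfrak{n}=(x_1,\ldots,x_n)\subset S$. For $f\in\mathfrak{n}$ and $1\le r\le n$ define $$d^r(f)=\frac{f(0,\ldots,0,x_r,\ldots,x_n)-f(0,\ldots,0,x_{r+1},\ldots,x_n)}{x_r}\in S.$$ For a permutation $\sigma$ of $\{1,\ldots,n\}$, let $\sigma$ also denote the $K$-algebra automorphism of $S$ with $x_i\mapsto x_{\sigma(i)}$, and set $d^i_\sigma(f)=\sigma\bigl(d^i(f(x_{\sigma^{-1}(1)},\ldots,x_{\sigma^{-1}(n)}))\bigr)$, i.e. $d^i_\sigma=\sigma\circ d^i\circ\sigma^{-1}$. For a proper ideal $I=(f_1,\ldots,f_m)$ (graded in the polynomial case, so $I\subset\mathfrak{n}$), $d_\sigma(I)$ is the ideal of $S$ generated by all $d^i_\sigma(f_j)$, $1\le i\le n$, $1\le j\le m$ (independent of the choice of generators). A proper ideal $I$ is called $d_\sigma$-Golod if $d_\sigma(I)^2\subset I$, and strongly $d$-Golod if it is $d_\sigma$-Golod for every permutation $\sigma$ of $\{1,\ldots,n\}$. A monomial ideal is an ideal generated by monomials in $x_1,\ldots,x_n$. The saturation of an ideal $I$ with respect to an ideal $J$ is $\bigcup_{t\ge1}I:J^t$. The saturation of $I$ with respect to $\mathfrak{n}$ is denoted $\widetilde I$. The $k$th symbolic power $I^{(k)}$ is the saturation of $I^k$ with respect to the intersection of all associated, non-minimal prime ideals of $I^k$ (this intersection being $S$ if there are none). *)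

theory Defs
  imports
    "HOL-Library.Poly_Mapping"
    "HOL-Combinatorics.Permutations"
    "HOL-Algebra.Ideal_Product"
begin

section \<open>Power series and polynomials in \<open>x\<^sub>1, \<dots>, x\<^sub>n\<close>\<close>

text \<open>
  A series is the function sending an exponent vector \<open>m\<close> to the coefficient of
  \<open>x\<^sub>1^m\<^sub>1 \<cdots> x\<^sub>n^m\<^sub>n\<close>.  Both rings live on this one type; they differ only in their carriers.
\<close>

type_synonym expo = "nat \<Rightarrow>\<^sub>0 nat"
type_synonym 'k series = "expo \<Rightarrow> 'k"

definition xvec :: "nat \<Rightarrow> expo"
  where "xvec i = Poly_Mapping.single i 1"

definition series_mult :: "'k::field series \<Rightarrow> 'k series \<Rightarrow> 'k series"
  where "series_mult f g = (\<lambda>m. \<Sum>(a, b) | a + b = m. f a * g b)"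

definition monomial :: "expo \<Rightarrow> 'k::field series"
  where "monomial u = (\<lambda>m. if m = u then 1 else 0)"

definition power_series_ring :: "nat \<Rightarrow> 'k::field series ring"
  where "power_series_ring n =
    \<lparr> carrier = {f. \<forall>m. f m \<noteq> 0 \<longrightarrow> Poly_Mapping.keys m \<subseteq> {1..n}},
      mult = series_mult,
      one = monomial 0,
      zero = (\<lambda>_. 0),
      add = (\<lambda>f g m. f m + g m) \<rparr>"

definition polynomial_ring :: "nat \<Rightarrow> 'k::field series ring"
  where "polynomial_ring n =
    (power_series_ring n)
      \<lparr> carrier := {f \<in> carrier (power_series_ring n). finite {m. f m \<noteq> 0}} \<rparr>"

definition expo_degree :: "expo \<Rightarrow> nat"
  where "expo_degree m = (\<Sum>i\<in>Poly_Mapping.keys m. Poly_Mapping.lookup m i)"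

definition homogeneous_part :: "nat \<Rightarrow> 'k::field series \<Rightarrow> 'k series"
  where "homogeneous_part d f = (\<lambda>m. if expo_degree m = d then f m else 0)"

definition graded :: "'k::field series set \<Rightarrow> bool"
  where "graded I \<longleftrightarrow> (\<forall>f\<in>I. \<forall>d. homogeneous_part d f \<in> I)"

definition monomial_ideal :: "nat \<Rightarrow> 'k::field series ring \<Rightarrow> 'k series set \<Rightarrow> bool"
  where "monomial_ideal n S I \<longleftrightarrow>
    (\<exists>U. (\<forall>u\<in>U. Poly_Mapping.keys u \<subseteq> {1..n}) \<and> I = genideal S (monomial ` U))"

definition variables_ideal :: "nat \<Rightarrow> 'k::field series ring \<Rightarrow> 'k series set"
  where "variables_ideal n S = genideal S ((\<lambda>i. monomial (xvec i)) ` {1..n})"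


section \<open>Colon ideals, saturations, symbolic powers\<close>

abbreviation ideal_power :: "('a, 'b) ring_scheme \<Rightarrow> 'a set \<Rightarrow> nat \<Rightarrow> 'a set"
  where "ideal_power R I k \<equiv> I [^]\<^bsub>ideals_set R\<^esub> k"

definition colon :: "('a, 'b) ring_scheme \<Rightarrow> 'a set \<Rightarrow> 'a set \<Rightarrow> 'a set"
  where "colon R I J = {a \<in> carrier R. \<forall>b\<in>J. a \<otimes>\<^bsub>R\<^esub> b \<in> I}"

definition saturation :: "('a, 'b) ring_scheme \<Rightarrow> 'a set \<Rightarrow> 'a set \<Rightarrow> 'a set"
  where "saturation R I J = (\<Union>t\<in>{1..}. colon R I (ideal_power R J t))"

definition associated_primes :: "('a, 'b) ring_scheme \<Rightarrow> 'a set \<Rightarrow> 'a set set"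
  where "associated_primes R I =
    {P. primeideal P R \<and> (\<exists>a\<in>carrier R. P = {b \<in> carrier R. b \<otimes>\<^bsub>R\<^esub> a \<in> I})}"

definition minimal_primes :: "('a, 'b) ring_scheme \<Rightarrow> 'a set \<Rightarrow> 'a set set"
  where "minimal_primes R I =
    {P. primeideal P R \<and> I \<subseteq> P \<and> (\<forall>Q. primeideal Q R \<and> I \<subseteq> Q \<and> Q \<subseteq> P \<longrightarrow> Q = P)}"

text \<open>The intersection with \<open>carrier R\<close> makes the empty intersection the whole ring.\<close>

definition symbolic_power :: "('a, 'b) ring_scheme \<Rightarrow> 'a set \<Rightarrow> nat \<Rightarrow> 'a set"
  where "symbolic_power R I k =
    saturation R (ideal_power R I k)
      (carrier R \<inter> \<Inter> (associated_primes R (ideal_power R I k)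
                        - minimal_primes R (ideal_power R I k)))"


section \<open>The operators \<open>d\<^sup>r\<close> and Golod-type ideals\<close>

text \<open>\<open>vanish_below r f\<close> is \<open>f(0, \<dots>, 0, x\<^sub>r, \<dots>, x\<^sub>n)\<close>.\<close>

definition vanish_below :: "nat \<Rightarrow> 'k::field series \<Rightarrow> 'k series"
  where "vanish_below r f = (\<lambda>m. if Poly_Mapping.keys m \<subseteq> {r..} then f m else 0)"

text \<open>
  Division by \<open>x\<^sub>r\<close> is the index shift; that the quotient is exact is lemma
  \<open>xvec_d_op\<close> below.
\<close>

definition d_op :: "nat \<Rightarrow> 'k::field series \<Rightarrow> 'k series"
  where "d_op r f = (\<lambda>m. vanish_below r f (m + xvec r) - vanish_below (Suc r) f (m + xvec r))"

text \<open>
  The automorphism \<open>x\<^sub>i \<mapsto> x\<^bsub>\<sigma> i\<^esub>\<close>: it sends \<open>x^u\<close> to \<open>x^m\<close> with \<open>m\<^bsub>\<sigma> i\<^esub> = u\<^sub>i\<close>, so the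
  coefficient of \<open>x^m\<close> in the image is that of \<open>x^(m \<circ> \<sigma>)\<close> in \<open>f\<close>
  (lemmas \<open>permute_vars_var\<close> and \<open>permute_vars_mult\<close>).
\<close>

definition permute_vars :: "(nat \<Rightarrow> nat) \<Rightarrow> 'k::field series \<Rightarrow> 'k series"
  where "permute_vars \<sigma> f = (\<lambda>m. f (Poly_Mapping.map_key \<sigma> m))"

definition d_perm :: "(nat \<Rightarrow> nat) \<Rightarrow> nat \<Rightarrow> 'k::field series \<Rightarrow> 'k series"
  where "d_perm \<sigma> i f = permute_vars \<sigma> (d_op i (permute_vars (inv_into UNIV \<sigma>) f))"

text \<open>
  \<open>d_ideal n S \<sigma> F\<close> is the ideal generated by all \<open>d\<^sup>i\<^sub>\<sigma>(f)\<close> with \<open>f \<in> F\<close>.  If \<open>F\<close> generates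
  an ideal \<open>I\<close> contained in \<open>(x\<^sub>1, \<dots>, x\<^sub>n)\<close>, this does not depend on the choice of \<open>F\<close> (lemma
  \<open>d_ideal_generators\<close>), so \<open>d\<^sub>\<sigma>(I)\<close> is \<open>d_ideal n S \<sigma> I\<close>.
\<close>

definition d_ideal ::
    "nat \<Rightarrow> 'k::field series ring \<Rightarrow> (nat \<Rightarrow> nat) \<Rightarrow> 'k series set \<Rightarrow> 'k series set"
  where "d_ideal n S \<sigma> F = genideal S {d_perm \<sigma> i f | i f. i \<in> {1..n} \<and> f \<in> F}"

definition d_golod ::
    "nat \<Rightarrow> 'k::field series ring \<Rightarrow> (nat \<Rightarrow> nat) \<Rightarrow> 'k series set \<Rightarrow> bool"
  where "d_golod n S \<sigma> I \<longleftrightarrow>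
    ideal I S \<and> I \<noteq> carrier S \<and> (S = polynomial_ring n \<longrightarrow> graded I) \<and>
    ideal_power S (d_ideal n S \<sigma> I) 2 \<subseteq> I"

definition strongly_d_golod :: "nat \<Rightarrow> 'k::field series ring \<Rightarrow> 'k series set \<Rightarrow> bool"
  where "strongly_d_golod n S I \<longleftrightarrow> (\<forall>\<sigma>. \<sigma> permutes {1..n} \<longrightarrow> d_golod n S \<sigma> I)"


section \<open>The two rings are commutative rings\<close>

lemma keys_add_nat:
  fixes a b :: expo
  shows "Poly_Mapping.keys (a + b) = Poly_Mapping.keys a \<union> Poly_Mapping.keys b"
  by (auto simp: in_keys_iff lookup_add)

lemma finite_decomp: "finite {(a, b). a + b = (m :: expo)}"
proof -
  let ?L = "{f :: nat \<Rightarrow> nat. \<forall>x. (x \<in> Poly_Mapping.keys m \<longrightarrow> f x \<in> {..Max (range (Poly_Mapping.lookup m))}) \<and>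
                  (x \<notin> Poly_Mapping.keys m \<longrightarrow> f x = 0)}"
  have finL: "finite ?L"
    by (rule finite_set_of_finite_funs) auto
  have "range (Poly_Mapping.lookup m) \<subseteq> insert 0 (Poly_Mapping.lookup m ` Poly_Mapping.keys m)"
    by (auto simp: in_keys_iff)
  then have fin: "finite (range (Poly_Mapping.lookup m))"
    by (rule finite_subset) simp
  have sub: "Poly_Mapping.lookup ` fst ` {(a, b). a + b = m} \<subseteq> ?L"
  proof (rule image_subsetI, rule CollectI, intro allI)
    fix a x assume "a \<in> fst ` {(a, b). a + b = m}"
    then obtain b where m: "m = a + b" by auto
    have "Poly_Mapping.lookup m x \<le> Max (range (Poly_Mapping.lookup m))"
      using fin by (rule Max_ge) simp
    then show "(x \<in> Poly_Mapping.keys m \<longrightarrow> Poly_Mapping.lookup a x \<in> {..Max (range (Poly_Mapping.lookup m))}) \<and>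
        (x \<notin> Poly_Mapping.keys m \<longrightarrow> Poly_Mapping.lookup a x = 0)"
      by (auto simp: m in_keys_iff lookup_add)
  qed
  have "finite (fst ` {(a, b). a + b = m})"
  proof (rule finite_imageD)
    show "finite (Poly_Mapping.lookup ` fst ` {(a, b). a + b = m})"
      using sub finL by (rule finite_subset)
    show "inj_on Poly_Mapping.lookup (fst ` {(a, b). a + b = m})"
      by (rule inj_onI) (simp only: lookup_inject)
  qed
  moreover have "inj_on fst {(a, b). a + b = m}"
    by (rule inj_onI) auto
  ultimately show ?thesis
    by (rule finite_imageD)
qed

lemma finite_decomp': "finite {x. fst x + snd x = (m :: expo)}"
  using finite_decomp[of m] by (simp add: case_prod_beta')

lemma series_mult_alt: "series_mult f g m = (\<Sum>x | fst x + snd x = m. f (fst x) * g (snd x))"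
  unfolding series_mult_def by (rule sum.cong) auto

lemma series_mult_comm: "series_mult f g = series_mult g f"
  unfolding series_mult_def
  by (intro ext sum.reindex_bij_witness[of _ "\<lambda>(a, b). (b, a)" "\<lambda>(a, b). (b, a)"])
     (auto simp: add.commute mult.commute)

lemma series_mult_assoc: "series_mult (series_mult f g) h = series_mult f (series_mult g h)"
proof
  fix m :: expo
  have "series_mult (series_mult f g) h m =
      (\<Sum>x | fst x + snd x = m. \<Sum>y | fst y + snd y = fst x. f (fst y) * g (snd y) * h (snd x))"
    by (simp add: series_mult_alt sum_distrib_right)
  also have "\<dots> = (\<Sum>(x, y)\<in>Sigma {x. fst x + snd x = m} (\<lambda>x. {y. fst y + snd y = fst x}).
      f (fst y) * g (snd y) * h (snd x))"
    using finite_decomp' by (subst sum.Sigma) (auto simp: case_prod_beta)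
  also have "\<dots> = (\<Sum>(x, y)\<in>Sigma {x. fst x + snd x = m} (\<lambda>x. {y. fst y + snd y = snd x}).
      f (fst x) * (g (fst y) * h (snd y)))"
    by (rule sum.reindex_bij_witness
        [of _ "\<lambda>(x, y). ((fst x + fst y, snd y), (fst x, fst y))"
              "\<lambda>(x, y). ((fst y, snd y + snd x), (snd y, snd x))"])
       (auto simp: algebra_simps)
  also have "\<dots> = (\<Sum>x | fst x + snd x = m. \<Sum>y | fst y + snd y = snd x. f (fst x) * (g (fst y) * h (snd y)))"
    using finite_decomp' by (subst sum.Sigma) (auto simp: case_prod_beta)
  also have "\<dots> = series_mult f (series_mult g h) m"
    by (simp add: series_mult_alt sum_distrib_left)
  finally show "series_mult (series_mult f g) h m = series_mult f (series_mult g h) m" .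
qed

lemma series_mult_distrib:
  "series_mult (\<lambda>m. f m + g m) h = (\<lambda>m. series_mult f h m + series_mult g h m)"
  by (rule ext) (simp add: series_mult_def case_prod_beta distrib_right sum.distrib)

lemma series_mult_diff:
  "series_mult (\<lambda>m. f m - g m) h = (\<lambda>m. series_mult f h m - series_mult g h m)"
  by (rule ext) (simp add: series_mult_def case_prod_beta left_diff_distrib sum_subtractf)

lemma series_mult_monomial: "series_mult (monomial u) f (u + m) = f m"
proof -
  have "series_mult (monomial u) f (u + m) = (\<Sum>x\<in>{(u, m)}. monomial u (fst x) * f (snd x))"
    unfolding series_mult_alt
    using finite_decomp'[of "u + m"]
    by (intro sum.mono_neutral_right) (auto simp: monomial_def)
  then show ?thesis by (simp add: monomial_def)
qed

lemma series_mult_monomial_outside: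
  assumes "\<And>b. m \<noteq> u + b"
  shows "series_mult (monomial u) f m = 0"
  unfolding series_mult_def
  by (rule sum.neutral) (use assms in \<open>auto simp: monomial_def\<close>)

lemma series_mult_one: "series_mult (monomial 0) f = f"
  using series_mult_monomial[of 0 f] by (intro ext) simp

lemma series_mult_nonzeroE:
  assumes "series_mult f g m \<noteq> 0"
  obtains a b where "m = a + b" "f a \<noteq> 0" "g b \<noteq> 0"
proof -
  from assms obtain x where "x \<in> {(a, b). a + b = m}" "(case x of (a, b) \<Rightarrow> f a * g b) \<noteq> 0"
    unfolding series_mult_def using sum.not_neutral_contains_not_neutral by blast
  then show ?thesis using that by (cases x) auto
qed

lemma cring_series:
  fixes R :: "'k::field series ring"
  assumes "mult R = series_mult" "one R = monomial 0" "zero R = (\<lambda>_. 0)"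
    "add R = (\<lambda>f g m. f m + g m)"
    and "monomial 0 \<in> carrier R" "(\<lambda>_. 0) \<in> carrier R"
    and "\<And>f g. f \<in> carrier R \<Longrightarrow> g \<in> carrier R \<Longrightarrow> series_mult f g \<in> carrier R"
    and "\<And>f g. f \<in> carrier R \<Longrightarrow> g \<in> carrier R \<Longrightarrow> (\<lambda>m. f m + g m) \<in> carrier R"
    and uminus: "\<And>f. f \<in> carrier R \<Longrightarrow> (\<lambda>m. - f m) \<in> carrier R"
  shows "cring R"
proof (rule cringI)
  show "abelian_group R"
  proof (rule abelian_groupI)
    fix f assume "f \<in> carrier R"
    then show "\<exists>g\<in>carrier R. g \<oplus>\<^bsub>R\<^esub> f = \<zero>\<^bsub>R\<^esub>"
      by (intro bexI[OF _ uminus]) (auto simp: assms)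
  qed (auto simp: assms algebra_simps)
  show "Group.comm_monoid R"
    by (rule comm_monoidI) (auto simp: assms series_mult_assoc series_mult_one intro: series_mult_comm)
qed (simp only: assms(1,4) series_mult_distrib)

theorem cring_power_series_ring: "cring (power_series_ring n :: 'k::field series ring)"
proof (rule cring_series)
  fix f g :: "'k series"
  assume fg: "f \<in> carrier (power_series_ring n)" "g \<in> carrier (power_series_ring n)"
  then have keys: "Poly_Mapping.keys m \<subseteq> {1..n}" if "f m \<noteq> 0 \<or> g m \<noteq> 0" for m
    using that unfolding power_series_ring_def by (simp del: One_nat_def) blast
  have "Poly_Mapping.keys m \<subseteq> {1..n}" if "series_mult f g m \<noteq> 0" for m
    using that
  proof (rule series_mult_nonzeroE)
    fix a b assume "m = a + b" "f a \<noteq> 0" "g b \<noteq> 0"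
    then show "Poly_Mapping.keys m \<subseteq> {1..n}"
      using keys[of a] keys[of b] by (simp add: keys_add_nat)
  qed
  then show "series_mult f g \<in> carrier (power_series_ring n)"
    unfolding power_series_ring_def by simp
  have "f m \<noteq> 0 \<or> g m \<noteq> 0" if "f m + g m \<noteq> 0" for m
    using that by auto
  then show "(\<lambda>m. f m + g m) \<in> carrier (power_series_ring n)"
    using keys unfolding power_series_ring_def partial_object.simps by blast
qed (auto simp: power_series_ring_def monomial_def split: if_splits)

theorem cring_polynomial_ring: "cring (polynomial_ring n :: 'k::field series ring)"
proof (rule cring_series)
  interpret P: cring "power_series_ring n :: 'k series ring"
    by (rule cring_power_series_ring)
  fix f g :: "'k series"
  assume fg: "f \<in> carrier (polynomial_ring n)" "g \<in> carrier (polynomial_ring n)"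
  then have carr: "f \<in> carrier (power_series_ring n)" "g \<in> carrier (power_series_ring n)"
    and fin: "finite {m. f m \<noteq> 0}" "finite {m. g m \<noteq> 0}"
    by (auto simp: polynomial_ring_def)
  have "{m. series_mult f g m \<noteq> 0} \<subseteq> (\<lambda>(a, b). a + b) ` ({m. f m \<noteq> 0} \<times> {m. g m \<noteq> 0})"
    by (auto elim!: series_mult_nonzeroE)
  then have "finite {m. series_mult f g m \<noteq> 0}"
    using fin by (meson finite_SigmaI finite_imageI finite_subset)
  then show "series_mult f g \<in> carrier (polynomial_ring n)"
    using P.m_closed[OF carr] by (simp add: polynomial_ring_def power_series_ring_def)
  have "{m. f m + g m \<noteq> 0} \<subseteq> {m. f m \<noteq> 0} \<union> {m. g m \<noteq> 0}"
    by auto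
  then have "finite {m. f m + g m \<noteq> 0}"
    using fin by (meson finite_UnI finite_subset)
  then show "(\<lambda>m. f m + g m) \<in> carrier (polynomial_ring n)"
    using P.a_closed[OF carr] by (simp add: polynomial_ring_def power_series_ring_def)
qed (auto simp: polynomial_ring_def power_series_ring_def monomial_def split: if_splits)

text \<open>The multiplication is the one of the library's polynomials \<open>expo \<Rightarrow>\<^sub>0 'k\<close>.\<close>

lemma lookup_times:
  fixes p q :: "expo \<Rightarrow>\<^sub>0 'k::field"
  shows "Poly_Mapping.lookup (p * q) = series_mult (Poly_Mapping.lookup p) (Poly_Mapping.lookup q)"
proof
  fix m
  let ?f = "Poly_Mapping.lookup p" and ?g = "Poly_Mapping.lookup q"
  have "Poly_Mapping.lookup (p * q) m = prod_fun ?f ?g m"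
    by (simp add: times_poly_mapping.rep_eq)
  also have "\<dots> = (\<Sum>(a, b). ?f a * ?g b when m = a + b)"
    by (rule prod_fun_unfold_prod) simp_all
  also have "\<dots> = (\<Sum>(a, b) | a + b = m. ?f a * ?g b when m = a + b)"
    by (rule Sum_any.expand_superset) (auto simp: finite_decomp)
  also have "\<dots> = series_mult ?f ?g m"
    unfolding series_mult_def by (rule sum.cong) auto
  finally show "Poly_Mapping.lookup (p * q) m = series_mult ?f ?g m" .
qed


section \<open>The operators are the intended ones\<close>

lemma keys_Suc_iff:
  "Poly_Mapping.keys m \<subseteq> {Suc r..} \<longleftrightarrow> Poly_Mapping.keys m \<subseteq> {r..} \<and> Poly_Mapping.lookup m r = (0::nat)"
proof
  assume "Poly_Mapping.keys m \<subseteq> {Suc r..}"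
  then have le: "Suc r \<le> i" if "i \<in> Poly_Mapping.keys m" for i
    using that by blast
  have "r \<notin> Poly_Mapping.keys m"
    using le[of r] by linarith
  moreover have "Poly_Mapping.keys m \<subseteq> {r..}"
    by (rule subsetI) (simp add: Suc_leD[OF le])
  ultimately show "Poly_Mapping.keys m \<subseteq> {r..} \<and> Poly_Mapping.lookup m r = 0"
    by (simp add: in_keys_iff)
next
  assume *: "Poly_Mapping.keys m \<subseteq> {r..} \<and> Poly_Mapping.lookup m r = 0"
  show "Poly_Mapping.keys m \<subseteq> {Suc r..}"
  proof
    fix i assume i: "i \<in> Poly_Mapping.keys m"
    then have "i \<in> {r..}" using * by blast
    moreover have "i \<noteq> r" using i * by (metis in_keys_iff)
    ultimately show "i \<in> {Suc r..}" by simp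
  qed
qed

lemma xvec_decomp:
  fixes m :: expo
  assumes "Poly_Mapping.lookup m r \<noteq> 0"
  obtains b where "m = xvec r + b"
proof
  show "m = xvec r + (m - xvec r)"
    using assms by (intro poly_mapping_eqI) (auto simp: lookup_add lookup_minus lookup_single when_def xvec_def)
qed

theorem xvec_d_op:
  "series_mult (monomial (xvec r)) (d_op r f) = (\<lambda>m. vanish_below r f m - vanish_below (Suc r) f m)"
proof
  fix m :: expo
  show "series_mult (monomial (xvec r)) (d_op r f) m = vanish_below r f m - vanish_below (Suc r) f m"
  proof (cases "Poly_Mapping.lookup m r = 0")
    case True
    then have "m \<noteq> xvec r + b" for b
      by (auto simp: lookup_add xvec_def)
    then show ?thesis
      using True by (simp add: series_mult_monomial_outside vanish_below_def keys_Suc_iff)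
  next
    case False
    then obtain b where "m = xvec r + b" by (rule xvec_decomp)
    then show ?thesis
      by (simp only: series_mult_monomial) (simp add: d_op_def add.commute)
  qed
qed

lemma vanish_below_mult: "vanish_below r (series_mult f g) = series_mult (vanish_below r f) (vanish_below r g)"
proof
  fix m :: expo
  show "vanish_below r (series_mult f g) m = series_mult (vanish_below r f) (vanish_below r g) m"
  proof (cases "Poly_Mapping.keys m \<subseteq> {r..}")
    case True
    then have "series_mult (vanish_below r f) (vanish_below r g) m = series_mult f g m"
      unfolding series_mult_alt
      by (intro sum.cong) (auto simp: vanish_below_def keys_add_nat)
    then show ?thesis using True by (simp add: vanish_below_def)
  next
    case False
    then have "series_mult (vanish_below r f) (vanish_below r g) m = 0"
      unfolding series_mult_alt
      by (intro sum.neutral) (auto simp: vanish_below_def keys_add_nat)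
    then show ?thesis using False by (simp add: vanish_below_def)
  qed
qed

lemma map_key_var:
  assumes "bij \<sigma>"
  shows "Poly_Mapping.map_key \<sigma> m = xvec i \<longleftrightarrow> m = xvec (\<sigma> i)"
proof
  assume eq: "Poly_Mapping.map_key \<sigma> m = xvec i"
  show "m = xvec (\<sigma> i)"
  proof (rule poly_mapping_eqI)
    fix k
    obtain j where k: "k = \<sigma> j" using assms by (metis bij_pointE)
    have "Poly_Mapping.lookup m k = Poly_Mapping.lookup (Poly_Mapping.map_key \<sigma> m) j"
      using assms by (simp add: k map_key.rep_eq bij_is_inj)
    then show "Poly_Mapping.lookup m k = Poly_Mapping.lookup (xvec (\<sigma> i)) k"
      using assms by (simp add: eq k lookup_single when_def bij_is_inj inj_eq xvec_def)
  qed
qed (use assms in \<open>simp add: map_key_single bij_is_inj xvec_def\<close>)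

lemma permute_vars_var:
  assumes "bij \<sigma>"
  shows "permute_vars \<sigma> (monomial (xvec i)) = monomial (xvec (\<sigma> i))"
  using assms by (auto simp: permute_vars_def monomial_def map_key_var)

lemma map_key_inverse:
  assumes "bij \<sigma>"
  shows "Poly_Mapping.map_key \<sigma> (Poly_Mapping.map_key (inv_into UNIV \<sigma>) m) = m"
    "Poly_Mapping.map_key (inv_into UNIV \<sigma>) (Poly_Mapping.map_key \<sigma> m) = m"
proof -
  have inj: "inj \<sigma>" "inj (inv_into UNIV \<sigma>)"
    using assms by (simp_all add: bij_is_inj bij_imp_bij_inv)
  have "inv_into UNIV \<sigma> \<circ> \<sigma> = (\<lambda>x. x)" "\<sigma> \<circ> inv_into UNIV \<sigma> = (\<lambda>x. x)"
    using assms by (auto simp: bij_is_inj bij_is_surj surj_f_inv_f)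
  then show "Poly_Mapping.map_key \<sigma> (Poly_Mapping.map_key (inv_into UNIV \<sigma>) m) = m"
    "Poly_Mapping.map_key (inv_into UNIV \<sigma>) (Poly_Mapping.map_key \<sigma> m) = m"
    by (simp_all only: map_key_compose[OF inj] map_key_compose[OF inj(2,1)] map_key_id)
qed

lemma permute_vars_mult:
  assumes "bij \<sigma>"
  shows "permute_vars \<sigma> (series_mult f g) = series_mult (permute_vars \<sigma> f) (permute_vars \<sigma> g)"
proof
  fix m :: expo
  have inj: "inj \<sigma>" "inj (inv_into UNIV \<sigma>)"
    using assms by (simp_all add: bij_is_inj bij_imp_bij_inv)
  show "permute_vars \<sigma> (series_mult f g) m = series_mult (permute_vars \<sigma> f) (permute_vars \<sigma> g) m"
    unfolding permute_vars_def series_mult_def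
    by (rule sum.reindex_bij_witness
        [of _ "\<lambda>(a, b). (Poly_Mapping.map_key \<sigma> a, Poly_Mapping.map_key \<sigma> b)"
              "\<lambda>(a, b). (Poly_Mapping.map_key (inv_into UNIV \<sigma>) a, Poly_Mapping.map_key (inv_into UNIV \<sigma>) b)"])
       (auto simp: map_key_inverse[OF assms] map_key_plus[OF inj(1), symmetric]
          map_key_plus[OF inj(2), symmetric])
qed

lemma permute_vars_add: "permute_vars \<sigma> (\<lambda>m. f m + g m) = (\<lambda>m. permute_vars \<sigma> f m + permute_vars \<sigma> g m)"
  by (simp add: permute_vars_def)

lemma d_op_add: "d_op r (\<lambda>m. f m + g m) = (\<lambda>m. d_op r f m + d_op r g m)"
  by (auto simp: d_op_def vanish_below_def)

lemma d_op_mult: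
  "d_op r (series_mult f g) =
    (\<lambda>m. series_mult (d_op r f) (vanish_below r g) m + series_mult (vanish_below (Suc r) f) (d_op r g) m)"
  (is "_ = ?R")
proof -
  let ?X = "monomial (xvec r)"
  let ?a = "vanish_below r f" and ?a' = "vanish_below (Suc r) f"
  let ?b = "vanish_below r g" and ?b' = "vanish_below (Suc r) g"
  have X1: "series_mult ?X (series_mult (d_op r f) ?b) =
      (\<lambda>m. series_mult ?a ?b m - series_mult ?a' ?b m)"
    unfolding series_mult_assoc[symmetric] xvec_d_op series_mult_diff ..
  have "series_mult ?X (series_mult ?a' (d_op r g)) = series_mult ?X (series_mult (d_op r g) ?a')"
    by (simp only: series_mult_comm[of ?a'])
  also have "\<dots> = (\<lambda>m. series_mult ?b ?a' m - series_mult ?b' ?a' m)"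
    unfolding series_mult_assoc[symmetric] xvec_d_op series_mult_diff ..
  also have "\<dots> = (\<lambda>m. series_mult ?a' ?b m - series_mult ?a' ?b' m)"
    by (simp only: series_mult_comm[of ?a'])
  finally have X2: "series_mult ?X (series_mult ?a' (d_op r g)) = \<dots>" .
  have "series_mult ?X ?R = series_mult ?R ?X"
    by (rule series_mult_comm)
  also have "\<dots> = (\<lambda>m. series_mult (series_mult (d_op r f) ?b) ?X m
      + series_mult (series_mult ?a' (d_op r g)) ?X m)"
    by (rule series_mult_distrib)
  also have "\<dots> = (\<lambda>m. series_mult ?X (series_mult (d_op r f) ?b) m
      + series_mult ?X (series_mult ?a' (d_op r g)) m)"
    by (simp only: series_mult_comm[of _ ?X])
  also have "\<dots> = series_mult ?X (d_op r (series_mult f g))"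
    unfolding X1 X2 xvec_d_op vanish_below_mult by simp
  finally have eq: "series_mult ?X (d_op r (series_mult f g)) = series_mult ?X ?R" ..
  show ?thesis
  proof
    fix m
    show "d_op r (series_mult f g) m = ?R m"
      using fun_cong[OF eq, of "xvec r + m"] unfolding series_mult_monomial .
  qed
qed

lemma series_ring_simps:
  assumes "S = power_series_ring n \<or> S = polynomial_ring n"
  shows "mult S = series_mult" "one S = monomial 0" "zero S = (\<lambda>_. 0)"
    "add S = (\<lambda>f g m. f m + g m)"
  using assms by (auto simp: power_series_ring_def polynomial_ring_def)

lemma cring_series_ring:
  assumes "S = power_series_ring n \<or> S = polynomial_ring n"
  shows "cring S"
  using assms cring_power_series_ring cring_polynomial_ring by auto

lemma series_ring_carrierI:
  assumes "S = power_series_ring n \<or> S = polynomial_ring n" and "f \<in> carrier S"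
    and "\<And>m. g m \<noteq> 0 \<Longrightarrow> Poly_Mapping.keys m \<subseteq> {1..n}"
    and "finite {m. f m \<noteq> 0} \<Longrightarrow> finite {m. g m \<noteq> 0}"
  shows "g \<in> carrier S"
  using assms by (auto simp: power_series_ring_def polynomial_ring_def)

lemma series_ring_keys:
  assumes "S = power_series_ring n \<or> S = polynomial_ring n" and "f \<in> carrier S" and "f m \<noteq> 0"
  shows "Poly_Mapping.keys m \<subseteq> {1..n}"
  using assms by (fastforce simp: power_series_ring_def polynomial_ring_def simp del: One_nat_def)

lemma vanish_below_closed:
  assumes S: "S = power_series_ring n \<or> S = polynomial_ring n" and f: "f \<in> carrier S"
  shows "vanish_below r f \<in> carrier S"
proof (rule series_ring_carrierI[OF S f])
  show "finite {m. vanish_below r f m \<noteq> 0}" if "finite {m. f m \<noteq> 0}"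
    by (rule finite_subset[OF _ that]) (auto simp: vanish_below_def)
qed (use series_ring_keys[OF S f] in \<open>auto simp: vanish_below_def split: if_splits\<close>)

lemma d_op_nonzero: "d_op r f m \<noteq> 0 \<Longrightarrow> f (m + xvec r) \<noteq> 0"
  by (auto simp: d_op_def vanish_below_def split: if_splits)

lemma d_op_closed:
  assumes S: "S = power_series_ring n \<or> S = polynomial_ring n" and f: "f \<in> carrier S"
  shows "d_op r f \<in> carrier S"
proof (rule series_ring_carrierI[OF S f])
  fix m assume "d_op r f m \<noteq> 0"
  then have "Poly_Mapping.keys (m + xvec r) \<subseteq> {1..n}"
    by (metis series_ring_keys[OF S f] d_op_nonzero)
  then show "Poly_Mapping.keys m \<subseteq> {1..n}"
    by (simp add: keys_add_nat)
next
  assume fin: "finite {m. f m \<noteq> 0}"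
  have "finite ((\<lambda>m. m + xvec r) -` {m. f m \<noteq> 0})"
    using fin by (rule finite_vimageI) (simp add: inj_on_def)
  then show "finite {m. d_op r f m \<noteq> 0}"
    by (rule rev_finite_subset) (auto dest: d_op_nonzero)
qed

lemma permute_vars_closed:
  assumes S: "S = power_series_ring n \<or> S = polynomial_ring n" and f: "f \<in> carrier S"
    and \<sigma>: "\<sigma> permutes {1..n}"
  shows "permute_vars \<sigma> f \<in> carrier S"
proof (rule series_ring_carrierI[OF S f])
  fix m assume "permute_vars \<sigma> f m \<noteq> 0"
  then have "Poly_Mapping.keys (Poly_Mapping.map_key \<sigma> m) \<subseteq> {1..n}"
    unfolding permute_vars_def by (rule series_ring_keys[OF S f])
  then have "\<sigma> -` Poly_Mapping.keys m \<subseteq> {1..n}"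
    using permutes_inj[OF \<sigma>] by (simp add: keys_map_key)
  then have "\<sigma> ` (\<sigma> -` Poly_Mapping.keys m) \<subseteq> {1..n}"
    using permutes_image[OF \<sigma>] by blast
  then show "Poly_Mapping.keys m \<subseteq> {1..n}"
    using permutes_surj[OF \<sigma>] by (simp add: surj_image_vimage_eq)
next
  assume fin: "finite {m. f m \<noteq> 0}"
  have "inj (Poly_Mapping.map_key \<sigma> :: expo \<Rightarrow> expo)"
    by (rule inj_on_inverseI, rule map_key_inverse(2)[OF permutes_bij[OF \<sigma>]])
  then have "finite ((Poly_Mapping.map_key \<sigma> :: expo \<Rightarrow> expo) -` {m. f m \<noteq> 0})"
    using fin by (intro finite_vimageI)
  then show "finite {m. permute_vars \<sigma> f m \<noteq> 0}"
    by (rule rev_finite_subset) (auto simp: permute_vars_def)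
qed

lemma d_perm_closed:
  assumes "S = power_series_ring n \<or> S = polynomial_ring n" and "f \<in> carrier S"
    and "\<sigma> permutes {1..n}"
  shows "d_perm \<sigma> i f \<in> carrier S"
  unfolding d_perm_def
  by (rule permute_vars_closed[OF assms(1) d_op_closed[OF assms(1)
        permute_vars_closed[OF assms(1,2) permutes_inv[OF assms(3)]]] assms(3)])

lemma variables_ideal_constant_term:
  fixes S :: "'k::field series ring" (structure)
  assumes S: "S = power_series_ring n \<or> S = polynomial_ring n"
    and f: "f \<in> variables_ideal n S"
  shows "f 0 = 0"
proof -
  interpret cring S using S by (rule cring_series_ring)
  let ?M = "{f \<in> carrier S. f 0 = 0}"
  note simps = series_ring_simps[OF S]
  have dec0: "{(a, b). a + b = (0 :: expo)} = {(0, 0)}"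
  proof -
    have "a + b = 0 \<longleftrightarrow> a = 0 \<and> b = 0" for a b :: expo
    proof
      assume "a + b = 0"
      then have "Poly_Mapping.keys a \<union> Poly_Mapping.keys b = {}"
        using keys_add_nat[of a b] by simp
      then show "a = 0 \<and> b = 0" by simp
    qed simp
    then show ?thesis by (simp only:) auto
  qed
  then have mult0: "series_mult f g 0 = f 0 * g 0" for f g :: "'k series"
    by (simp add: series_mult_def)
  have "ideal ?M S"
  proof (rule idealI)
    have neg: "\<ominus> f \<in> ?M" if "f \<in> ?M" for f
    proof -
      have "\<ominus> f = (\<ominus> \<one>) \<otimes> f" using that l_minus[of \<one> f] by auto
      moreover have "((\<ominus> \<one>) \<otimes> f) 0 = 0" using that by (simp add: simps(1) mult0)
      ultimately show ?thesis using that by simp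
    qed
    have add: "f \<oplus> g \<in> ?M" if "f \<in> ?M" "g \<in> ?M" for f g
    proof -
      have "(f \<oplus> g) 0 = 0" using that by (simp add: simps(4))
      then show ?thesis using that by simp
    qed
    have "\<zero> 0 = 0" by (simp add: simps(3))
    then have zero: "\<zero> \<in> ?M" by simp
    show "subgroup ?M (add_monoid S)"
    proof (rule add.subgroupI)
      show "?M \<noteq> {}" using zero by blast
    qed (use neg add in \<open>auto simp: a_inv_def\<close>)
    show "g \<otimes> f \<in> ?M" if "f \<in> ?M" "g \<in> carrier S" for f g
    proof -
      have "(g \<otimes> f) 0 = 0" using that by (simp add: simps(1) mult0)
      then show ?thesis using that by simp
    qed
    then show "f \<otimes> g \<in> ?M" if "f \<in> ?M" "g \<in> carrier S" for f g
      using that m_comm[of f g] by fastforce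
  qed (rule ring_axioms)
  moreover have "(\<lambda>i. monomial (xvec i)) ` {1..n} \<subseteq> ?M"
  proof (rule image_subsetI)
    fix i assume "i \<in> {1..n}"
    then have "monomial (xvec i) \<in> carrier S"
      using S by (auto simp: power_series_ring_def polynomial_ring_def monomial_def xvec_def split: if_splits)
    moreover have "xvec i \<noteq> 0"
      by (metis One_nat_def lookup_single_eq lookup_zero nat.distinct(1) xvec_def)
    ultimately show "monomial (xvec i) \<in> ?M" by (simp add: monomial_def)
  qed
  ultimately have "variables_ideal n S \<subseteq> ?M"
    unfolding variables_ideal_def by (rule genideal_minimal)
  then show ?thesis using f by auto
qed

theorem d_ideal_generators:
  fixes S :: "'k::field series ring" (structure)
  assumes S: "S = power_series_ring n \<or> S = polynomial_ring n" and \<sigma>: "\<sigma> permutes {1..n}"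
    and F: "F \<subseteq> carrier S" and I: "I = genideal S F" "I \<subseteq> variables_ideal n S"
  shows "d_ideal n S \<sigma> F = d_ideal n S \<sigma> I"
proof -
  interpret cring S using S by (rule cring_series_ring)
  note simps = series_ring_simps[OF S]
  define p where "p = (permute_vars \<sigma> :: 'k series \<Rightarrow> _)"
  define q where "q = (permute_vars (inv_into UNIV \<sigma>) :: 'k series \<Rightarrow> _)"
  let ?D = "d_ideal n S \<sigma> F"
  have bij: "bij \<sigma>" "bij (inv_into UNIV \<sigma>)"
    using permutes_bij[OF \<sigma>] by (simp_all add: bij_imp_bij_inv)
  have pq: "p f \<in> carrier S" "q f \<in> carrier S" if "f \<in> carrier S" for f
    using that permute_vars_closed[OF S _ \<sigma>] permute_vars_closed[OF S _ permutes_inv[OF \<sigma>]]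
    by (auto simp: p_def q_def)
  have dp: "d_perm \<sigma> i f = p (d_op i (q f))" for i f
    by (simp add: d_perm_def p_def q_def)
  have gens: "{d_perm \<sigma> i f | i f. i \<in> {1..n} \<and> f \<in> H} \<subseteq> carrier S" if "H \<subseteq> carrier S" for H
    using that d_perm_closed[OF S _ \<sigma>] by auto
  interpret D: ideal ?D S
    unfolding d_ideal_def by (rule genideal_ideal[OF gens[OF F]])
  have Icarr: "I \<subseteq> carrier S"
    using ideal.Icarr[OF genideal_ideal[OF F]] I by auto
  define T where "T = {h \<in> I. \<forall>i\<in>{1..n}. d_perm \<sigma> i h \<in> ?D}"
  interpret I: ideal I S using genideal_ideal[OF F] I by simp
  have q0: "q f 0 = f 0" for f :: "'k series"
    by (simp add: q_def permute_vars_def map_key_zero[OF bij_is_inj[OF bij(2)]])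
  have below: "p (vanish_below r (q f)) \<in> ?D" if f: "f \<in> T" and r: "r \<le> Suc n" "1 \<le> r" for f r
    using r
  proof (induction r rule: inc_induct)
    case base
    have fI: "f \<in> I" using f by (simp add: T_def)
    then have "q f \<in> carrier S" using pq Icarr by auto
    have z: "vanish_below (Suc n) (q f) = \<zero>"
    proof -
      have "vanish_below (Suc n) (q f) m = 0" for m
      proof (cases "m = 0")
        case True
        then show ?thesis
          using variables_ideal_constant_term[OF S] fI I by (auto simp: vanish_below_def q0)
      next
        case False
        show ?thesis
        proof (rule ccontr)
          assume "\<not> ?thesis"
          then have k: "Poly_Mapping.keys m \<subseteq> {Suc n..}" "q f m \<noteq> 0"
            by (auto simp: vanish_below_def split: if_splits)
          then have "Poly_Mapping.keys m \<subseteq> {1..n}"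
            using series_ring_keys[OF S \<open>q f \<in> carrier S\<close>] by blast
          with k(1) have "Poly_Mapping.keys m = {}" by fastforce
          with False show False by simp
        qed
      qed
      then show ?thesis by (auto simp: simps)
    qed
    have "p \<zero> = \<zero>" by (simp add: simps p_def permute_vars_def)
    then show ?case by (simp add: z)
  next
    case (step r)
    have r: "r \<in> {1..n}" using step by auto
    have "vanish_below r (q f) =
        (\<lambda>m. series_mult (monomial (xvec r)) (d_op r (q f)) m + vanish_below (Suc r) (q f) m)"
      by (simp add: xvec_d_op)
    then have "p (vanish_below r (q f)) =
        p (monomial (xvec r)) \<otimes> p (d_op r (q f)) \<oplus> p (vanish_below (Suc r) (q f))"
      by (simp add: p_def permute_vars_add permute_vars_mult[OF bij(1)] simps)
    moreover have "p (d_op r (q f)) \<in> ?D"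
      using f r by (auto simp: T_def dp)
    moreover have "p (vanish_below (Suc r) (q f)) \<in> ?D"
      using step by simp
    moreover have "monomial (xvec r) \<in> carrier S"
      using S r by (auto simp: power_series_ring_def polynomial_ring_def monomial_def xvec_def split: if_splits)
    ultimately show ?case
      by (auto intro!: D.a_closed D.I_l_closed pq)
  qed
  have mult: "g \<otimes> f \<in> T" if f: "f \<in> T" and g: "g \<in> carrier S" for f g
  proof -
    have fI: "f \<in> I" using f by (simp add: T_def)
    have "d_perm \<sigma> i (g \<otimes> f) \<in> ?D" if i: "i \<in> {1..n}" for i
    proof -
      have "d_perm \<sigma> i (f \<otimes> g) = p (d_op i (q f)) \<otimes> p (vanish_below i (q g))
          \<oplus> p (vanish_below (Suc i) (q f)) \<otimes> p (d_op i (q g))"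
        by (simp add: dp p_def q_def permute_vars_add permute_vars_mult[OF bij(1)]
            permute_vars_mult[OF bij(2)] d_op_mult simps)
      moreover have "p (d_op i (q f)) \<in> ?D" using f i by (simp add: T_def dp)
      moreover have "p (vanish_below (Suc i) (q f)) \<in> ?D" using below[OF f, of "Suc i"] i by simp
      moreover have "p (vanish_below i (q g)) \<in> carrier S" "p (d_op i (q g)) \<in> carrier S"
        using g pq vanish_below_closed[OF S] d_op_closed[OF S] by auto
      ultimately have "d_perm \<sigma> i (f \<otimes> g) \<in> ?D"
        by (simp add: D.a_closed D.I_r_closed)
      then show ?thesis using m_comm[of f g] g fI Icarr by auto
    qed
    then show ?thesis using fI g by (simp add: T_def I.I_l_closed)
  qed
  have add: "f \<oplus> g \<in> T" if "f \<in> T" "g \<in> T" for f g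
  proof -
    have "d_perm \<sigma> i (f \<oplus> g) = d_perm \<sigma> i f \<oplus> d_perm \<sigma> i g" for i
      by (simp add: dp p_def q_def permute_vars_add d_op_add simps)
    then show ?thesis using that by (auto simp: T_def D.a_closed I.a_closed)
  qed
  have FI: "F \<subseteq> I" using genideal_self[OF F] I by simp
  have FT: "F \<subseteq> T"
  proof
    fix f assume "f \<in> F"
    then have "d_perm \<sigma> i f \<in> ?D" if "i \<in> {1..n}" for i
      using that genideal_self[OF gens[OF F]] unfolding d_ideal_def by blast
    then show "f \<in> T" using \<open>f \<in> F\<close> FI by (auto simp: T_def)
  qed
  have zero: "\<zero> \<in> T"
  proof -
    have "d_perm \<sigma> i \<zero> = \<zero>" for i
      by (simp add: d_perm_def permute_vars_def d_op_def vanish_below_def simps)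
    then show ?thesis by (simp add: T_def D.zero_closed I.zero_closed)
  qed
  have TI: "T \<subseteq> carrier S" using Icarr by (auto simp: T_def)
  have "ideal T S"
  proof (rule idealI)
    have "\<ominus> f \<in> T" if "f \<in> T" for f
    proof -
      have "\<ominus> f = (\<ominus> \<one>) \<otimes> f" using that TI l_minus[of \<one> f] by auto
      then show ?thesis using mult[OF that, of "\<ominus> \<one>"] by simp
    qed
    then show "subgroup T (add_monoid S)"
      using TI zero add by (intro add.subgroupI) (auto simp: a_inv_def)
    show "f \<otimes> g \<in> T" if "f \<in> T" "g \<in> carrier S" for f g
      using mult[OF that] m_comm[of f g] that TI by auto
  qed (use mult in \<open>auto simp: ring_axioms\<close>)
  then have "I \<subseteq> T"
    unfolding I(1) using FT by (rule genideal_minimal)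
  then have "d_ideal n S \<sigma> I \<subseteq> ?D"
    unfolding d_ideal_def[of n S \<sigma> I]
    by (intro genideal_minimal D.is_ideal) (auto simp: T_def)
  moreover have "?D \<subseteq> d_ideal n S \<sigma> I"
    unfolding d_ideal_def
    by (intro subset_Idl_subset gens[OF Icarr]) (use FI in blast)
  ultimately show ?thesis by auto
qed

end

theory Submission
  imports Defs "HOL-Library.Set_Algebras"
begin

text \<open>
  Parts (a) and (b) follow from the product rule for \<open>d\<^sup>i\<^sub>\<sigma>\<close>: since every \<open>f\<close> in \<open>I \<subseteq> (x\<^sub>1, \<dots>, x\<^sub>n)\<close> is a
  combination of the \<open>d\<^sup>i\<^sub>\<sigma>(f)\<close>, one gets \<open>d\<^sub>\<sigma>(IJ) \<subseteq> d\<^sub>\<sigma>(I) d\<^sub>\<sigma>(J)\<close>.  For a monomial ideal, being strongly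
  \<open>d\<close>-Golod means that \<open>(u / x\<^sub>i) (v / x\<^sub>j) \<in> I\<close> for all monomials \<open>u, v \<in> I\<close> and all variables
  \<open>x\<^sub>i\<close>, \<open>x\<^sub>j\<close> dividing \<open>u\<close>, \<open>v\<close>; powers \<open>I\<^sup>k\<close> with \<open>k \<ge> 2\<close> have this property because \<open>u / x\<^sub>i \<in> I\<^bsup>k-1\<^esup>\<close>, and it
  passes to \<open>I : J\<close> when \<open>I : J = I : J\<^sup>2\<close>.  A saturation is such a colon ideal by Dickson's
  lemma, and symbolic powers are covered because associated primes of monomial ideals are
  monomial, also in the power series ring.
\<close>

section \<open>Dickson's lemma\<close>

text \<open>Induction on the set of coordinates. Let \<open>B\<close> dominate \<open>X\<close> on
  \<open>K\<close> and let \<open>N\<close> be its largest \<open>k\<close>-coordinate: a point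
  whose \<open>k\<close>-coordinate is at least \<open>N\<close> is then dominated by
  \<open>B\<close> at \<open>k\<close> as well. The other points lie in the finitely many slices
  \<open>c x k = j\<close> with \<open>j < N\<close>, and each slice has a finite dominating set on
  \<open>K\<close> by induction.\<close>

lemma dickson:
  fixes c :: "'x \<Rightarrow> 'a \<Rightarrow> nat"
  assumes "finite K"
  shows "\<exists>B\<subseteq>X. finite B \<and> (\<forall>x\<in>X. \<exists>b\<in>B. \<forall>i\<in>K. c b i \<le> c x i)"
  using assms
proof (induction K arbitrary: X rule: finite_induct)
  case empty
  show ?case
  proof (cases "X = {}")
    case False
    then obtain x where "x \<in> X" by auto
    then show ?thesis by (intro exI[of _ "{x}"]) auto
  qed auto
next
  case (insert k K)
  obtain B where B: "B \<subseteq> X" "finite B" "\<And>x. x \<in> X \<Longrightarrow> \<exists>b\<in>B. \<forall>i\<in>K. c b i \<le> c x i"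
    using insert.IH[of X] by auto
  define P where "P = (\<lambda>j F. F \<subseteq> {x\<in>X. c x k = j} \<and> finite F \<and>
      (\<forall>x\<in>{x\<in>X. c x k = j}. \<exists>b\<in>F. \<forall>i\<in>K. c b i \<le> c x i))"
  have "\<exists>F. P j F" for j
    unfolding P_def by (rule insert.IH)
  then obtain F where "\<And>j. P j (F j)" by metis
  then have F: "F j \<subseteq> {x\<in>X. c x k = j}" "finite (F j)"
      "x \<in> X \<Longrightarrow> c x k = j \<Longrightarrow> \<exists>b\<in>F j. \<forall>i\<in>K. c b i \<le> c x i" for j x
    unfolding P_def by blast+
  \<comment> \<open>If \<open>B\<close> is empty then so is \<open>X\<close>, so the unspecified
    value of \<open>Max {}\<close> does no harm.\<close>
  define N where "N = Max ((\<lambda>b. c b k) ` B)"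
  let ?B = "B \<union> (\<Union>j<N. F j)"
  have "\<exists>b\<in>?B. \<forall>i\<in>insert k K. c b i \<le> c x i" if x: "x \<in> X" for x
  proof (cases "c x k < N")
    case True
    then obtain b where "b \<in> F (c x k)" "\<forall>i\<in>K. c b i \<le> c x i"
      using F(3)[OF x refl] by blast
    then show ?thesis using True F(1)[of "c x k"] by (intro bexI[of _ b]) auto
  next
    case False
    obtain b where b: "b \<in> B" "\<forall>i\<in>K. c b i \<le> c x i" using B(3)[OF x] by auto
    then have "c b k \<le> N" unfolding N_def using B(2) by (intro Max_ge) auto
    then show ?thesis using b False by (intro bexI[of _ b]) auto
  qed
  moreover have "?B \<subseteq> X" using B(1) F(1) by blast
  moreover have "finite ?B" using B(2) F(2) by simp
  ultimately show ?case by blast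
qed

section \<open>Exponent vectors of monomials in n variables\<close>

definition expos :: "nat \<Rightarrow> expo set"
  where "expos n = {m. Poly_Mapping.keys m \<subseteq> {1..n}}"

lemma expos_add_iff: "a + b \<in> expos n \<longleftrightarrow> a \<in> expos n \<and> b \<in> expos n"
  by (auto simp: expos_def keys_add_nat)

lemma zero_expos [simp]: "0 \<in> expos n"
  by (simp add: expos_def)

lemma xvec_expos [simp]: "xvec i \<in> expos n \<longleftrightarrow> i \<in> {1..n}"
  by (simp add: expos_def xvec_def)

lemma expo_dickson:
  assumes "X \<subseteq> expos n"
  obtains B where "B \<subseteq> X" "finite B" "\<And>m. m \<in> X \<Longrightarrow> \<exists>b\<in>B. \<exists>d\<in>expos n. m = b + d"
proof -
  obtain B where B: "B \<subseteq> X" "finite B"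
    "\<And>m. m \<in> X \<Longrightarrow> \<exists>b\<in>B. \<forall>i\<in>{1..n}. Poly_Mapping.lookup b i \<le> Poly_Mapping.lookup m i"
    using dickson[of "{1..n}" X Poly_Mapping.lookup] by auto
  have "\<exists>b\<in>B. \<exists>d\<in>expos n. m = b + d" if m: "m \<in> X" for m
  proof -
    obtain b where b: "b \<in> B" "\<And>i. i \<in> {1..n} \<Longrightarrow> Poly_Mapping.lookup b i \<le> Poly_Mapping.lookup m i"
      using B(3)[OF m] by blast
    \<comment> \<open>Outside \<open>{1..n}\<close> the coordinates of \<open>b\<close> vanish, so
      the domination holds at every coordinate and the truncated difference \<open>m - b\<close> is
      exact.\<close>
    have "b \<in> expos n" using b B assms by auto
    then have "Poly_Mapping.lookup b i \<le> Poly_Mapping.lookup m i" for i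
      using b(2)[of i] in_keys_iff[of i b] by (cases "i \<in> {1..n}") (auto simp: expos_def)
    then have "m = b + (m - b)"
      by (intro poly_mapping_eqI) (simp add: lookup_add lookup_minus)
    then show ?thesis
      using b(1) m assms expos_add_iff[of b "m - b" n] by (intro bexI[of _ b] bexI[of _ "m - b"]) auto
  qed
  then show ?thesis using B that by blast
qed

lemma expo_nonneg: "0 \<le> (d :: expo)"
proof (rule ccontr)
  assume "\<not> 0 \<le> d"
  then have "d < 0" by simp
  then show False by (auto simp: less_poly_mapping_def less_fun_def)
qed

text \<open>The order on \<open>expo\<close> is lexicographic and respects addition, so a monomial
  never lies above its multiples and the least Dickson generator is least in \<open>X\<close>. The
  bound on the variables matters: over all variables, x_1 > x_2 > ... descends forever.\<close>

lemma expo_lex_least: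
  assumes "X \<subseteq> expos n" "X \<noteq> {}"
  obtains m where "m \<in> X" "\<And>x. x \<in> X \<Longrightarrow> m \<le> x"
proof -
  obtain B where B: "B \<subseteq> X" "finite B" "\<And>m. m \<in> X \<Longrightarrow> \<exists>b\<in>B. \<exists>d\<in>expos n. m = b + d"
    using expo_dickson[OF assms(1)] by metis
  show ?thesis
  proof
    have "B \<noteq> {}" using B(3) assms(2) by auto
    then show "Min B \<in> X" using B(1,2) Min_in by blast
    fix x assume "x \<in> X"
    then obtain b d where b: "b \<in> B" "x = b + d" using B(3) by blast
    have "b + 0 \<le> b + d" by (rule add_left_mono[OF expo_nonneg])
    then show "Min B \<le> x" using b Min_le[OF B(2) b(1)] by (metis add.right_neutral order_trans)
  qed
qed

lemma keys_xvec_decomp: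
  assumes "i \<in> Poly_Mapping.keys m"
  obtains b where "m = xvec i + b"
  using assms xvec_decomp[of m i] by (auto simp: in_keys_iff)

lemma expo_degree_add: "expo_degree (a + b) = expo_degree a + expo_degree b"
proof -
  let ?K = "Poly_Mapping.keys a \<union> Poly_Mapping.keys b"
  have "expo_degree m = (\<Sum>i\<in>?K. Poly_Mapping.lookup m i)" if "Poly_Mapping.keys m \<subseteq> ?K" for m
    unfolding expo_degree_def
    by (rule sum.mono_neutral_left) (use that in \<open>auto simp: in_keys_iff\<close>)
  then show ?thesis
    by (simp add: keys_add_nat lookup_add sum.distrib)
qed

lemma expo_degree_eq_0 [simp]: "expo_degree m = 0 \<longleftrightarrow> m = 0"
  by (auto simp: expo_degree_def in_keys_iff intro: poly_mapping_eqI)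

lemma expo_degree_xvec: "expo_degree (xvec i) = 1"
  by (simp add: expo_degree_def xvec_def)

section \<open>Monomial ideals\<close>

text \<open>These are the exponent sets of monomial ideals; statements about monomial ideals are
  reduced to statements about them.\<close>

definition upset :: "nat \<Rightarrow> expo set \<Rightarrow> bool"
  where "upset n M \<longleftrightarrow> M \<subseteq> expos n \<and> (\<forall>m\<in>M. \<forall>d\<in>expos n. m + d \<in> M)"

lemma upsetD: "upset n M \<Longrightarrow> m \<in> M \<Longrightarrow> m \<in> expos n"
  and upset_add: "upset n M \<Longrightarrow> m \<in> M \<Longrightarrow> d \<in> expos n \<Longrightarrow> m + d \<in> M"
  by (auto simp: upset_def)

lemma upset_add': "upset n M \<Longrightarrow> m \<in> M \<Longrightarrow> d \<in> expos n \<Longrightarrow> d + m \<in> M"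
  by (simp only: add.commute[of d m] upset_add)

lemma upset_subset: "upset n M \<Longrightarrow> M \<subseteq> expos n"
  by (simp add: upset_def)

lemma upset_expos: "upset n (expos n)"
  by (auto simp: upset_def expos_add_iff)

lemma upset_set_plus:
  assumes M: "M \<subseteq> expos n" and N: "upset n N"
  shows "upset n (M + N)"
  unfolding upset_def
proof (intro conjI ballI subsetI)
  fix m assume "m \<in> M + N"
  then obtain a b where m: "m = a + b" "a \<in> M" "b \<in> N" by (rule set_plus_elim)
  then show "m \<in> expos n" using M upsetD[OF N] by (auto simp: expos_add_iff)
  fix d assume "d \<in> expos n"
  then have "a + (b + d) \<in> M + N" using m N by (intro set_plus_intro upset_add)
  then show "m + d \<in> M + N" by (simp add: m add.assoc)
qed

section \<open>Ideals spanned by monomials, in both rings at once\<close>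

locale series_ring =
  fixes n :: nat and S :: "'k::field series ring" (structure)
  assumes S: "S = power_series_ring n \<or> S = polynomial_ring n"
begin

sublocale cring S using S by (rule cring_series_ring)

lemmas ops = series_ring_simps[OF S]

lemma supp_expos: "f \<in> carrier S \<Longrightarrow> f m \<noteq> 0 \<Longrightarrow> m \<in> expos n"
  using series_ring_keys[OF S] by (simp add: expos_def)

text \<open>Membership in either carrier depends only on the support and passes to smaller supports,
  so one argument serves both rings.\<close>

lemma carrier_mono:
  assumes "f \<in> carrier S" "\<And>m. g m \<noteq> 0 \<Longrightarrow> f m \<noteq> 0"
  shows "g \<in> carrier S"
proof (rule series_ring_carrierI[OF S assms(1)])
  show "finite {m. g m \<noteq> 0}" if "finite {m. f m \<noteq> 0}"
    by (rule finite_subset[OF _ that]) (use assms in auto)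
qed (use assms series_ring_keys[OF S] in blast)

lemma monomial_closed [simp]: "monomial m \<in> carrier S \<longleftrightarrow> m \<in> expos n"
proof -
  have "{k. monomial m k \<noteq> (0::'k)} = {m}" "\<And>P. (\<forall>k. monomial m k \<noteq> (0::'k) \<longrightarrow> P k) \<longleftrightarrow> P m"
    by (auto simp: monomial_def)
  then show ?thesis
    using S by (auto simp only: power_series_ring_def polynomial_ring_def expos_def
        partial_object.simps mem_Collect_eq finite.intros)
qed

lemma monomial_mult: "monomial a \<otimes> monomial b = monomial (a + b)"
proof
  fix m
  show "(monomial a \<otimes> monomial b) m = monomial (a + b) m"
  proof (cases "\<exists>c. m = a + c")
    case True
    then obtain c where m: "m = a + c" by blast
    show ?thesis unfolding ops m series_mult_monomial by (simp add: monomial_def)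
  next
    case False
    then have "series_mult (monomial a) (monomial b) m = (0::'k)"
      by (intro series_mult_monomial_outside) auto
    then show ?thesis using False by (auto simp: ops monomial_def)
  qed
qed

lemma cut_closed: "f \<in> carrier S \<Longrightarrow> (\<lambda>m. if P m then f m else 0) \<in> carrier S"
  by (erule carrier_mono) (simp split: if_splits)

lemma shift_closed:
  assumes "f \<in> carrier S"
  shows "(\<lambda>m. f (b + m)) \<in> carrier S"
proof (rule series_ring_carrierI[OF S assms])
  show "finite {m. f (b + m) \<noteq> 0}" if "finite {m. f m \<noteq> 0}"
  proof -
    have "finite ((\<lambda>m. b + m) -` {m. f m \<noteq> 0})"
      using that by (rule finite_vimageI) (simp add: inj_on_def)
    then show ?thesis by (simp add: vimage_def)
  qed
  fix m assume "f (b + m) \<noteq> 0"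
  then show "Poly_Mapping.keys m \<subseteq> {1..n}"
    using series_ring_keys[OF S assms] by (force simp: keys_add_nat)
qed

lemma idealI':
  assumes "I \<subseteq> carrier S" "\<zero> \<in> I" "\<And>f g. f \<in> I \<Longrightarrow> g \<in> I \<Longrightarrow> f \<oplus> g \<in> I"
    and mult: "\<And>f g. f \<in> I \<Longrightarrow> g \<in> carrier S \<Longrightarrow> g \<otimes> f \<in> I"
  shows "ideal I S"
proof (rule idealI)
  have "\<ominus> f \<in> I" if "f \<in> I" for f
  proof -
    have "\<ominus> f = (\<ominus> \<one>) \<otimes> f" using that assms(1) l_minus[of \<one> f] by auto
    then show ?thesis using mult[OF that, of "\<ominus> \<one>"] by simp
  qed
  then show "subgroup I (add_monoid S)"
    using assms by (intro add.subgroupI) (auto simp: a_inv_def)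
  show "f \<otimes> g \<in> I" if "f \<in> I" "g \<in> carrier S" for f g
    using mult[OF that] m_comm[of f g] that assms(1) by auto
qed (use mult in \<open>auto simp: ring_axioms\<close>)

text \<open>A condition on supports instead of generators: membership is decided coefficient by
  coefficient, also for series with infinitely many terms.\<close>

definition mspan :: "expo set \<Rightarrow> 'k series set"
  where "mspan M = {f \<in> carrier S. \<forall>m. f m \<noteq> 0 \<longrightarrow> m \<in> M}"

lemma mspan_mono: "M \<subseteq> N \<Longrightarrow> mspan M \<subseteq> mspan N"
  by (auto simp: mspan_def)

lemma mspan_expos: "mspan (expos n) = carrier S"
  by (auto simp: mspan_def dest: supp_expos)

lemma monomial_mspan_iff: "monomial m \<in> mspan M \<longleftrightarrow> m \<in> expos n \<and> m \<in> M"
  by (auto simp: mspan_def) (auto simp: monomial_def split: if_splits)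

lemma mult_mspan:
  assumes "f \<in> mspan M" "g \<in> mspan N"
  shows "f \<otimes> g \<in> mspan (M + N)"
proof -
  have "m \<in> M + N" if "series_mult f g m \<noteq> 0" for m
    using that
  proof (rule series_mult_nonzeroE)
    fix a b assume "m = a + b" "f a \<noteq> 0" "g b \<noteq> 0"
    then show ?thesis using assms by (auto simp: mspan_def)
  qed
  moreover have "f \<otimes> g \<in> carrier S" using assms by (auto simp: mspan_def)
  ultimately show ?thesis by (simp add: mspan_def ops)
qed

lemma expos_plus_upset: "upset n M \<Longrightarrow> expos n + M = M"
proof
  show "M \<subseteq> expos n + M" using set_plus_intro[of 0 "expos n" _ M] by auto
qed (auto elim!: set_plus_elim intro: upset_add')

lemma add_mspan: "f \<in> mspan M \<Longrightarrow> g \<in> mspan M \<Longrightarrow> f \<oplus> g \<in> mspan M"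
  by (auto simp: mspan_def) (metis add_0 ops(4))

lemma ideal_mspan:
  assumes M: "upset n M"
  shows "ideal (mspan M) S"
proof (rule idealI')
  show "g \<otimes> f \<in> mspan M" if "f \<in> mspan M" "g \<in> carrier S" for f g
    using mult_mspan[of g "expos n" f M] that expos_plus_upset[OF M] by (simp add: mspan_expos)
  show "\<zero> \<in> mspan M" by (simp add: mspan_def) (simp add: ops)
  show "mspan M \<subseteq> carrier S" by (auto simp: mspan_def)
qed (rule add_mspan)

lemma graded_mspan: "graded (mspan M)"
  by (auto simp: graded_def mspan_def homogeneous_part_def intro: cut_closed)

text \<open>An element of \<open>mspan M\<close> may have infinite support; by Dickson's lemma it is still a finite
  combination of monomials.\<close>

lemma mspan_subset_ideal:
  assumes I: "ideal I S" and M: "M \<subseteq> expos n" "\<And>m. m \<in> M \<Longrightarrow> monomial m \<in> I"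
  shows "mspan M \<subseteq> I"
proof
  interpret I: ideal I S by (rule I)
  fix f assume f: "f \<in> mspan M"
  obtain B where B: "B \<subseteq> M" "finite B" "\<And>m. m \<in> M \<Longrightarrow> \<exists>b\<in>B. \<exists>d\<in>expos n. m = b + d"
    using expo_dickson[OF M(1)] by metis
  have "f \<in> I" if "f \<in> carrier S" "\<forall>m. f m \<noteq> 0 \<longrightarrow> (\<exists>b\<in>B. \<exists>d. m = b + d)" for f
    using B(2,1) that
  proof (induction B arbitrary: f rule: finite_induct)
    case empty
    then have "f = \<zero>" by (auto simp: ops)
    then show ?case by simp
  next
    case (insert b B)
    let ?P = "\<lambda>m. \<exists>d. m = b + d"
    \<comment> \<open>The terms of \<open>f\<close> divisible by the monomial of \<open>b\<close>
      are gathered into that monomial times \<open>?g\<close>; every term left in \<open>?h\<close>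
      is divisible by a monomial from the remaining \<open>B\<close>.\<close>
    let ?g = "\<lambda>m. f (b + m)" and ?h = "\<lambda>m. if \<not> ?P m then f m else 0"
    have h: "?h \<in> I"
      using insert.prems by (intro insert.IH cut_closed) (auto split: if_splits)
    have g: "monomial b \<otimes> ?g \<in> I"
      using insert.prems M(2) by (intro I.I_r_closed shift_closed) auto
    have "f = monomial b \<otimes> ?g \<oplus> ?h"
    proof
      fix m
      show "f m = (monomial b \<otimes> ?g \<oplus> ?h) m"
      proof (cases "?P m")
        case True
        then show ?thesis by (auto simp: ops series_mult_monomial)
      next
        case False
        then show ?thesis using series_mult_monomial_outside[of m b ?g] by (auto simp: ops)
      qed
    qed
    then show ?case by (rule ssubst) (rule I.a_closed[OF g h])
  qed
  moreover have "f \<in> carrier S" using f by (simp add: mspan_def)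
  moreover have "\<exists>b\<in>B. \<exists>d. m = b + d" if "f m \<noteq> 0" for m
  proof -
    have "m \<in> M" using f that by (simp add: mspan_def)
    from B(3)[OF this] show ?thesis by blast
  qed
  ultimately show "f \<in> I" by simp
qed

lemma mspan_eq_carrier_iff:
  assumes "upset n M"
  shows "mspan M = carrier S \<longleftrightarrow> 0 \<in> M"
proof
  assume "mspan M = carrier S"
  then show "0 \<in> M" using monomial_mspan_iff[of 0 M] by simp
next
  assume "0 \<in> M"
  then have "\<one> \<in> mspan M" by (simp add: ops monomial_mspan_iff)
  then show "mspan M = carrier S" by (rule ideal.one_imp_carrier[OF ideal_mspan[OF assms]])
qed

text \<open>The exponent set consists of all multiples of the generators. One inclusion holds
  because the generated ideal is the smallest, the other because \<open>mspan_subset_ideal\<close>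
  asks only for monomials.\<close>

lemma monomial_idealE:
  assumes "monomial_ideal n S I"
  obtains M where "upset n M" "I = mspan M"
proof -
  obtain U where U: "\<And>u. u \<in> U \<Longrightarrow> u \<in> expos n" "I = genideal S (monomial ` U)"
    using assms by (auto simp: monomial_ideal_def expos_def)
  let ?M = "U + expos n"
  have M: "upset n ?M"
    using U(1) by (intro upset_set_plus upset_expos) blast
  have gens: "monomial ` U \<subseteq> carrier S" using U(1) by auto
  have I: "ideal I S" unfolding U(2) by (rule genideal_ideal[OF gens])
  have "U \<subseteq> ?M" using set_plus_intro[of _ U 0 "expos n"] by auto
  then have "I \<subseteq> mspan ?M"
    unfolding U(2) using U(1)
    by (intro genideal_minimal ideal_mspan[OF M]) (auto simp: monomial_mspan_iff)
  moreover have "mspan ?M \<subseteq> I"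
  proof (rule mspan_subset_ideal[OF I upset_subset[OF M]])
    fix m assume "m \<in> ?M"
    then obtain u d where m: "m = u + d" "u \<in> U" "d \<in> expos n" by (rule set_plus_elim)
    then have "monomial u \<in> I" using genideal_self[OF gens] U(2) by blast
    then show "monomial m \<in> I"
      using ideal.I_r_closed[OF I, of "monomial u" "monomial d"] m by (simp add: monomial_mult)
  qed
  ultimately show ?thesis using that M by blast
qed

lemma ideal_prod_mspan:
  assumes M: "upset n M" and N: "upset n N"
  shows "mspan M \<cdot> mspan N = mspan (M + N)"
proof
  show "mspan M \<cdot> mspan N \<subseteq> mspan (M + N)"
  proof
    fix f assume "f \<in> mspan M \<cdot> mspan N"
    then show "f \<in> mspan (M + N)"
      by induction (auto intro: mult_mspan add_mspan)
  qed
  show "mspan (M + N) \<subseteq> mspan M \<cdot> mspan N"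
  proof (rule mspan_subset_ideal)
    fix m assume "m \<in> M + N"
    then obtain a b where m: "m = a + b" "a \<in> M" "b \<in> N" by (rule set_plus_elim)
    then have "monomial a \<in> mspan M" "monomial b \<in> mspan N"
      using upsetD[OF M] upsetD[OF N] by (auto simp: monomial_mspan_iff)
    then show "monomial m \<in> mspan M \<cdot> mspan N"
      using ideal_prod.prod[of "monomial a" "mspan M" "monomial b" "mspan N" S] by (simp add: monomial_mult m)
  qed (use M N in \<open>auto intro!: ideal_prod_is_ideal ideal_mspan upset_subset upset_set_plus\<close>)
qed

lemma mult_ideals_set [simp]: "I \<otimes>\<^bsub>ideals_set S\<^esub> J = I \<cdot> J"
  and one_ideals_set [simp]: "\<one>\<^bsub>ideals_set S\<^esub> = carrier S"
  by (simp_all add: ideals_set_def)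

lemma ideal_power_2: "ideal I S \<Longrightarrow> ideal_power S I 2 = I \<cdot> I"
  by (simp add: numeral_2_eq_2 ideal_prod_one oneideal ideal_prod_commute[of "carrier S"])

section \<open>Powers, colons and saturations on exponents\<close>

primrec powset :: "expo set \<Rightarrow> nat \<Rightarrow> expo set" where
  "powset M 0 = expos n"
| "powset M (Suc k) = powset M k + M"

lemma upset_powset: "upset n M \<Longrightarrow> upset n (powset M k)"
  by (induction k) (auto simp: upset_expos upset_set_plus upset_subset)

lemma ideal_power_mspan: "upset n M \<Longrightarrow> ideal_power S (mspan M) k = mspan (powset M k)"
  by (induction k) (auto simp: mspan_expos ideal_prod_mspan upset_powset)

lemma powset_add:
  assumes "upset n M"
  shows "powset M (j + k) = powset M j + powset M k"
proof (induction k)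
  case 0
  show ?case using expos_plus_upset[OF upset_powset[OF assms]] by (simp add: add.commute)
next
  case (Suc k)
  then show ?case by (simp add: add.assoc)
qed

lemma powset_antimono:
  assumes "upset n M" "j \<le> k"
  shows "powset M k \<subseteq> powset M j"
proof -
  have "powset M k = powset M j + powset M (k - j)"
    using powset_add[OF assms(1), of j "k - j"] assms(2) by simp
  then show ?thesis
    using upset_powset[OF assms(1)] by (auto elim!: set_plus_elim intro: upset_add upsetD)
qed

definition colonset :: "expo set \<Rightarrow> expo set \<Rightarrow> expo set"
  where "colonset M N = {m \<in> expos n. \<forall>w\<in>N. m + w \<in> M}"

lemma upset_colonset:
  assumes "upset n M"
  shows "upset n (colonset M N)"
proof -
  have "m + d + w \<in> M" if "m + w \<in> M" "d \<in> expos n" for m d w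
    using upset_add[OF assms that] by (simp only: add.assoc add.commute[of d w])
  then show ?thesis by (simp add: upset_def colonset_def expos_add_iff subset_iff)
qed

text \<open>Multiplication by a monomial shifts the support without cancellation, so testing
  \<open>f\<close> against the monomials of \<open>N\<close> already constrains each term of
  \<open>f\<close> separately.\<close>

lemma colon_mspan:
  assumes M: "upset n M" and N: "upset n N"
  shows "colon S (mspan M) (mspan N) = mspan (colonset M N)"
proof
  show "mspan (colonset M N) \<subseteq> colon S (mspan M) (mspan N)"
  proof
    fix f assume f: "f \<in> mspan (colonset M N)"
    have "colonset M N + N \<subseteq> M" by (auto simp: colonset_def elim!: set_plus_elim)
    then have "f \<otimes> g \<in> mspan M" if "g \<in> mspan N" for g
      using mult_mspan[OF f that] mspan_mono by blast
    then show "f \<in> colon S (mspan M) (mspan N)"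
      using f by (auto simp: colon_def mspan_def)
  qed
  show "colon S (mspan M) (mspan N) \<subseteq> mspan (colonset M N)"
  proof
    fix f assume f: "f \<in> colon S (mspan M) (mspan N)"
    then have fc: "f \<in> carrier S" by (simp add: colon_def)
    have "m + w \<in> M" if m: "f m \<noteq> 0" and w: "w \<in> N" for m w
    proof -
      have "monomial w \<in> mspan N" using w upsetD[OF N] by (simp add: monomial_mspan_iff)
      then have "f \<otimes> monomial w \<in> mspan M" using f by (auto simp: colon_def)
      moreover have "(f \<otimes> monomial w) (w + m) = f m"
        unfolding ops series_mult_comm[of f] by (rule series_mult_monomial)
      ultimately show ?thesis using m by (auto simp: mspan_def add.commute)
    qed
    then show "f \<in> mspan (colonset M N)"
      using fc supp_expos by (auto simp: mspan_def colonset_def)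
  qed
qed

text \<open>The Noetherian property for monomial ideals: the finitely many Dickson generators of the
  union all occur at a common stage of the chain.\<close>

lemma chain_stabilizes:
  fixes C :: "nat \<Rightarrow> expo set"
  assumes C: "\<And>t. upset n (C t)" and mono: "\<And>j k. j \<le> k \<Longrightarrow> C j \<subseteq> C k"
  obtains T where "\<And>t. C t \<subseteq> C T"
proof -
  have "(\<Union>t. C t) \<subseteq> expos n" using upset_subset[OF C] by blast
  then obtain B where B: "B \<subseteq> (\<Union>t. C t)" "finite B"
    "\<And>m. m \<in> (\<Union>t. C t) \<Longrightarrow> \<exists>b\<in>B. \<exists>d\<in>expos n. m = b + d"
    using expo_dickson by metis
  then have "\<forall>b\<in>B. \<exists>t. b \<in> C t" by auto
  then obtain t where t: "\<And>b. b \<in> B \<Longrightarrow> b \<in> C (t b)" by metis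
  let ?T = "Max (t ` B)"
  have "B \<subseteq> C ?T"
  proof
    fix b assume b: "b \<in> B"
    then have "t b \<le> ?T" using B(2) by simp
    then show "b \<in> C ?T" using mono t[OF b] by blast
  qed
  then have "C s \<subseteq> C ?T" for s
    using B(3) upset_add[OF C] by blast
  then show ?thesis using that by blast
qed

lemma saturation_mspan:
  assumes M: "upset n M" and N: "upset n N"
  obtains T where "saturation S (mspan M) (mspan N) = mspan (colonset M (powset N T))"
    and "\<And>t. colonset M (powset N t) \<subseteq> colonset M (powset N T)"
proof -
  let ?C = "\<lambda>t. colonset M (powset N t)"
  have "?C j \<subseteq> ?C k" if "j \<le> k" for j k
    using powset_antimono[OF N that] by (auto simp: colonset_def)
  then obtain T where T: "\<And>t. ?C t \<subseteq> ?C T"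
    using chain_stabilizes[of ?C] upset_colonset[OF M] by metis
  \<comment> \<open>The saturation is a union over \<open>t \<ge> 1\<close>, while \<open>T\<close>
    may be 0; passing to \<open>Suc T\<close> puts the stable stage in range.\<close>
  have "?C (Suc T) = ?C T"
    using T[of "Suc T"] powset_antimono[OF N, of T "Suc T"] by (auto simp: colonset_def)
  have "saturation S (mspan M) (mspan N) = (\<Union>t\<in>{1..}. mspan (?C t))"
    unfolding saturation_def
    by (simp add: ideal_power_mspan[OF N] colon_mspan[OF M upset_powset[OF N]])
  also have "\<dots> = mspan (?C T)"
  proof
    show "(\<Union>t\<in>{1..}. mspan (?C t)) \<subseteq> mspan (?C T)"
      using mspan_mono[OF T] by blast
    have "mspan (?C T) = mspan (?C (Suc T))" using \<open>?C (Suc T) = ?C T\<close> by simp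
    then show "mspan (?C T) \<subseteq> (\<Union>t\<in>{1..}. mspan (?C t))" by auto
  qed
  finally show ?thesis using that T by blast
qed

end

section \<open>Golod conditions on exponents\<close>

text \<open>The two truncations in \<open>d_op\<close> differ exactly in the terms that contain the
  \<open>i\<close>-th variable and no earlier one. Hence the operator sends each monomial to a
  monomial or to 0, and distinct terms never cancel.\<close>

lemma d_perm_coeff:
  assumes \<sigma>: "bij \<sigma>"
  shows "d_perm \<sigma> i f m =
    (if \<forall>k\<in>Poly_Mapping.keys m. i \<le> inv_into UNIV \<sigma> k then f (m + xvec (\<sigma> i)) else 0)"
proof -
  let ?\<rho> = "inv_into UNIV \<sigma>"
  have inj: "inj \<sigma>" "inj ?\<rho>" and \<rho>: "bij ?\<rho>"
    using \<sigma> by (simp_all add: bij_is_inj bij_imp_bij_inv)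
  have x: "Poly_Mapping.map_key ?\<rho> (xvec i) = xvec (\<sigma> i)"
    using map_key_var[OF \<rho>] inj by simp
  have k: "\<sigma> -` Poly_Mapping.keys m \<subseteq> {r..} \<longleftrightarrow> (\<forall>k\<in>Poly_Mapping.keys m. r \<le> ?\<rho> k)" for r
  proof -
    have "\<sigma> -` Poly_Mapping.keys m = ?\<rho> ` Poly_Mapping.keys m"
      using bij_vimage_eq_inv_image[OF \<sigma>] .
    then show ?thesis by auto
  qed
  have "Poly_Mapping.keys (xvec i) = {i}" by (simp add: xvec_def)
  then show ?thesis
    unfolding d_perm_def permute_vars_def d_op_def vanish_below_def
    by (simp add: keys_add_nat keys_map_key inj map_key_plus map_key_inverse[OF \<sigma>] x k)
qed

text \<open>The exponents of the monomials \<open>d\<^sup>i\<^sub>\<sigma>(x\<^sup>u)\<close>, \<open>u \<in> M\<close>, are those \<open>u - e\<^bsub>\<sigma> i\<^esub>\<close> for which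
  \<open>\<sigma> i\<close> is the first variable of \<open>x\<^sup>u\<close> in the order \<open>\<sigma> 1, \<sigma> 2, \<dots>\<close>.\<close>

definition d_expos :: "nat \<Rightarrow> (nat \<Rightarrow> nat) \<Rightarrow> expo set \<Rightarrow> expo set"
  where "d_expos n \<sigma> M = {m. \<exists>i\<in>{1..n}. (\<forall>k\<in>Poly_Mapping.keys m. i \<le> inv_into UNIV \<sigma> k) \<and>
    m + xvec (\<sigma> i) \<in> M}"

text \<open>With u and v the monomials of exponents \<open>a + xvec i\<close> and
  \<open>b + xvec j\<close>, the quotients u / x_i and v / x_j have exponents \<open>a\<close> and
  \<open>b\<close>, so no subtraction occurs. The condition does not mention any
  permutation.\<close>

definition exchange :: "nat \<Rightarrow> expo set \<Rightarrow> bool"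
  where "exchange n M \<longleftrightarrow> (\<forall>a b. \<forall>i\<in>{1..n}. \<forall>j\<in>{1..n}.
    a + xvec i \<in> M \<longrightarrow> b + xvec j \<in> M \<longrightarrow> a + b \<in> M)"

lemma exchangeD:
  "exchange n M \<Longrightarrow> a + xvec i \<in> M \<Longrightarrow> b + xvec j \<in> M \<Longrightarrow> i \<in> {1..n} \<Longrightarrow> j \<in> {1..n} \<Longrightarrow> a + b \<in> M"
  unfolding exchange_def by blast

lemma permutes_first_second:
  assumes "i \<in> {1..n}" "j \<in> {1..n}" "i \<noteq> j"
  obtains \<sigma> where "\<sigma> permutes {1..n::nat}" "\<sigma> 1 = j" "\<sigma> 2 = i"
proof -
  \<comment> \<open>\<open>t\<close> is the position that the swap of 1 and \<open>j\<close> carries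
    to \<open>i\<close>, and it differs from 1. Swapping 2 with \<open>t\<close> beforehand
    therefore gives \<open>\<sigma> 2 = i\<close> and leaves \<open>\<sigma> 1 = j\<close>.\<close>
  define t where "t = Transposition.transpose 1 j i"
  define \<sigma> where "\<sigma> = Transposition.transpose 1 j \<circ> Transposition.transpose 2 t"
  have "2 \<in> {1..n}" using assms by auto
  moreover have "1 \<in> {1..n}" using assms by auto
  moreover have "t \<in> {1..n}" using assms by (auto simp: t_def Transposition.transpose_def)
  ultimately have "\<sigma> permutes {1..n}"
    unfolding \<sigma>_def using assms by (intro permutes_compose permutes_swap_id)
  moreover have "t \<noteq> 1" using assms by (auto simp: t_def Transposition.transpose_def)
  then have "\<sigma> 1 = j" by (simp add: \<sigma>_def)
  moreover have "\<sigma> 2 = i" by (simp add: \<sigma>_def t_def)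
  ultimately show ?thesis using that by blast
qed

lemma permutes_inv_pos:
  assumes "\<sigma> permutes {1..n}" "m \<in> expos n" "k \<in> Poly_Mapping.keys m"
  shows "1 \<le> inv_into UNIV \<sigma> k"
proof -
  have "k \<in> {1..n}" using assms(2,3) by (auto simp: expos_def)
  then have "inv_into UNIV \<sigma> k \<in> {1..n}"
    using permutes_in_image[OF permutes_inv[OF assms(1)]] by blast
  then show ?thesis by simp
qed

section \<open>Golod conditions tested on monomials\<close>

context series_ring
begin

lemma d_generators_closed:
  assumes "\<sigma> permutes {1..n}" "H \<subseteq> carrier S"
  shows "{d_perm \<sigma> i f | i f. i \<in> {1..n} \<and> f \<in> H} \<subseteq> carrier S"
  using d_perm_closed[OF S _ assms(1)] assms(2) by auto

lemma ideal_d_ideal: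
  assumes "\<sigma> permutes {1..n}" "H \<subseteq> carrier S"
  shows "ideal (d_ideal n S \<sigma> H) S"
  unfolding d_ideal_def by (rule genideal_ideal[OF d_generators_closed[OF assms]])

lemma d_perm_in_d_ideal:
  assumes "\<sigma> permutes {1..n}" "H \<subseteq> carrier S" "i \<in> {1..n}" "f \<in> H"
  shows "d_perm \<sigma> i f \<in> d_ideal n S \<sigma> H"
  unfolding d_ideal_def using genideal_self[OF d_generators_closed[OF assms(1,2)]] assms(3,4) by blast

lemma d_ideal_minimal:
  assumes "ideal D S" "\<And>i f. i \<in> {1..n} \<Longrightarrow> f \<in> H \<Longrightarrow> d_perm \<sigma> i f \<in> D"
  shows "d_ideal n S \<sigma> H \<subseteq> D"
  unfolding d_ideal_def using assms by (intro genideal_minimal) auto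

lemma ideal_power_2_subset:
  assumes "ideal D S" "\<And>f g. f \<in> D \<Longrightarrow> g \<in> D \<Longrightarrow> f \<otimes> g \<in> I" "ideal I S"
  shows "ideal_power S D 2 \<subseteq> I"
proof
  interpret I: ideal I S by (rule assms)
  fix f assume "f \<in> ideal_power S D 2"
  then have "f \<in> D \<cdot> D" by (simp only: ideal_power_2[OF assms(1)])
  then show "f \<in> I"
    by induction (auto intro: assms(2))
qed

lemma d_expos_subset:
  assumes "upset n M"
  shows "d_expos n \<sigma> M \<subseteq> expos n"
  using upset_subset[OF assms] expos_add_iff unfolding d_expos_def by blast

text \<open>Since the operators act term by term, the ideal d_\<sigma> of a monomial ideal is again
  monomial, generated by the exponents in \<open>d_expos\<close>. Containment of its square is then
  a condition on pairs of generators.\<close>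

lemma d_golod_mspan_iff:
  assumes M: "upset n M" and \<sigma>: "\<sigma> permutes {1..n}"
  shows "d_golod n S \<sigma> (mspan M) \<longleftrightarrow>
    0 \<notin> M \<and> (\<forall>a\<in>d_expos n \<sigma> M. \<forall>b\<in>d_expos n \<sigma> M. a + b \<in> M)"
proof -
  let ?D = "d_ideal n S \<sigma> (mspan M)" and ?E = "d_expos n \<sigma> M"
  note d = d_perm_coeff[OF permutes_bij[OF \<sigma>]]
  have MC: "mspan M \<subseteq> carrier S" by (auto simp: mspan_def)
  have D: "ideal ?D S" by (rule ideal_d_ideal[OF \<sigma> MC])
  have mono: "monomial a \<in> ?D" if a: "a \<in> ?E" for a
  proof -
    obtain i where i: "i \<in> {1..n}" "\<forall>k\<in>Poly_Mapping.keys a. i \<le> inv_into UNIV \<sigma> k"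
      "a + xvec (\<sigma> i) \<in> M"
      using a unfolding d_expos_def by blast
    have "monomial (a + xvec (\<sigma> i)) \<in> mspan M"
      using i(3) upsetD[OF M i(3)] by (simp add: monomial_mspan_iff)
    then have "d_perm \<sigma> i (monomial (a + xvec (\<sigma> i))) \<in> ?D"
      using i by (intro d_perm_in_d_ideal[OF \<sigma> MC])
    also have "d_perm \<sigma> i (monomial (a + xvec (\<sigma> i))) = monomial a"
      using i(2) by (auto simp: d monomial_def)
    finally show ?thesis .
  qed
  have "ideal_power S ?D 2 \<subseteq> mspan M \<longleftrightarrow> (\<forall>a\<in>?E. \<forall>b\<in>?E. a + b \<in> M)"
  proof
    assume sq: "ideal_power S ?D 2 \<subseteq> mspan M"
    show "\<forall>a\<in>?E. \<forall>b\<in>?E. a + b \<in> M"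
    proof (intro ballI)
      fix a b assume "a \<in> ?E" "b \<in> ?E"
      then have "monomial a \<otimes> monomial b \<in> ideal_power S ?D 2"
        unfolding ideal_power_2[OF D] by (intro ideal_prod.prod mono)
      then show "a + b \<in> M" using sq by (auto simp: monomial_mult monomial_mspan_iff)
    qed
  next
    assume E: "\<forall>a\<in>?E. \<forall>b\<in>?E. a + b \<in> M"
    \<comment> \<open>\<open>?E\<close> need not be closed under multiples: a factor in an earlier
      variable can destroy the first-variable condition. \<open>?U\<close> is its closure.\<close>
    let ?U = "?E + expos n"
    have U: "upset n ?U"
      by (rule upset_set_plus[OF d_expos_subset[OF M] upset_expos])
    have "d_perm \<sigma> i f \<in> mspan ?U" if "i \<in> {1..n}" "f \<in> mspan M" for i f
    proof -
      have "d_perm \<sigma> i f \<in> carrier S"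
        using that by (intro d_perm_closed[OF S _ \<sigma>]) (simp add: mspan_def)
      moreover have "m \<in> ?U" if "d_perm \<sigma> i f m \<noteq> 0" for m
      proof -
        have "m \<in> ?E"
          using that \<open>i \<in> {1..n}\<close> \<open>f \<in> mspan M\<close>
          by (auto simp: d d_expos_def mspan_def split: if_splits)
        then show ?thesis using set_plus_intro[of m ?E 0 "expos n"] by simp
      qed
      ultimately show ?thesis by (simp add: mspan_def)
    qed
    then have DU: "?D \<subseteq> mspan ?U" by (intro d_ideal_minimal ideal_mspan[OF U])
    have "?U + ?U \<subseteq> M"
    proof
      fix m assume "m \<in> ?U + ?U"
      then obtain a b c e where m: "m = (a + c) + (b + e)" "a \<in> ?E" "b \<in> ?E" "c \<in> expos n" "e \<in> expos n"
        by (auto elim!: set_plus_elim)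
      have "a + b \<in> M" using E m(2,3) by blast
      moreover have "c + e \<in> expos n" using m(4,5) by (simp add: expos_add_iff)
      ultimately have "(a + b) + (c + e) \<in> M" by (rule upset_add[OF M])
      then show "m \<in> M" by (simp add: m ac_simps)
    qed
    then have "f \<otimes> g \<in> mspan M" if "f \<in> ?D" "g \<in> ?D" for f g
      using mult_mspan[of f ?U g ?U] that DU mspan_mono by blast
    then show "ideal_power S ?D 2 \<subseteq> mspan M"
      by (rule ideal_power_2_subset[OF D _ ideal_mspan[OF M]])
  qed
  then show ?thesis
    unfolding d_golod_def using graded_mspan[of M] ideal_mspan[OF M] mspan_eq_carrier_iff[OF M] by blast
qed

text \<open>Every d_\<sigma> quotient is a quotient by some variable, so \<open>exchange\<close>
  suffices for all permutations. Conversely, for given \<open>a\<close>, \<open>b\<close>,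
  \<open>i\<close>, \<open>j\<close>, either the product lies in \<open>M\<close> for trivial
  reasons or one permutation makes both quotients d_\<sigma> quotients.\<close>

lemma strongly_d_golod_mspan_iff:
  assumes M: "upset n M"
  shows "strongly_d_golod n S (mspan M) \<longleftrightarrow> 0 \<notin> M \<and> exchange n M"
proof
  assume strong: "strongly_d_golod n S (mspan M)"
  then have golod: "d_golod n S \<sigma> (mspan M)" if "\<sigma> permutes {1..n}" for \<sigma>
    using that by (simp add: strongly_d_golod_def)
  have "a + b \<in> M" if ij: "i \<in> {1..n}" "j \<in> {1..n}" and ab: "a + xvec i \<in> M" "b + xvec j \<in> M" for a b i j
  proof (cases "j \<in> Poly_Mapping.keys a")
    case True
    \<comment> \<open>If x_j divides \<open>a\<close>, it can be moved over to \<open>b\<close>, and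
      the product becomes a multiple of the member \<open>b + xvec j\<close>.\<close>
    then obtain c where c: "a = xvec j + c" by (rule keys_xvec_decomp)
    then have "c \<in> expos n" using upsetD[OF M ab(1)] by (simp add: expos_add_iff)
    then have "(b + xvec j) + c \<in> M" by (rule upset_add[OF M ab(2)])
    then show ?thesis by (simp add: c ac_simps)
  next
    case False
    have abE: "a \<in> expos n" "b \<in> expos n"
      using upsetD[OF M ab(1)] upsetD[OF M ab(2)] by (simp_all add: expos_add_iff)
    show ?thesis
    proof (cases "i = j")
      case True
      \<comment> \<open>With x_i in first place, the first-variable condition holds automatically
        for both quotients.\<close>
      let ?\<tau> = "Transposition.transpose 1 i"
      have \<tau>: "?\<tau> permutes {1..n}" using ij by (intro permutes_swap_id) auto
      have "a \<in> d_expos n ?\<tau> M" "b \<in> d_expos n ?\<tau> M"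
        unfolding d_expos_def
        using ij ab True permutes_inv_pos[OF \<tau>] abE
        by (auto intro!: bexI[of _ 1])
      then show ?thesis using golod[OF \<tau>] unfolding d_golod_mspan_iff[OF M \<tau>] by blast
    next
      case ne: False
      \<comment> \<open>With x_j first and x_i second, the condition for \<open>b\<close> is
        automatic, and the condition for \<open>a\<close> holds because x_j does not divide
        it.\<close>
      obtain \<sigma> where \<sigma>: "\<sigma> permutes {1..n}" "\<sigma> 1 = j" "\<sigma> 2 = i"
        by (rule permutes_first_second[OF ij ne])
      have "2 \<le> inv_into UNIV \<sigma> k" if k: "k \<in> Poly_Mapping.keys a" for k
      proof -
        have "k = \<sigma> (inv_into UNIV \<sigma> k)" using permutes_inverses(1)[OF \<sigma>(1)] by simp
        then have "inv_into UNIV \<sigma> k \<noteq> 1" using False k \<sigma>(2) by metis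
        then show ?thesis using permutes_inv_pos[OF \<sigma>(1) abE(1) k] by linarith
      qed
      then have "a \<in> d_expos n \<sigma> M"
        unfolding d_expos_def using ab(1) \<sigma>(3) ij ne by (auto intro!: bexI[of _ 2])
      moreover have "b \<in> d_expos n \<sigma> M"
        unfolding d_expos_def using ab(2) \<sigma>(2) ij permutes_inv_pos[OF \<sigma>(1) abE(2)]
        by (auto intro!: bexI[of _ 1])
      ultimately show ?thesis using golod[OF \<sigma>(1)] by (simp add: d_golod_mspan_iff[OF M \<sigma>(1)])
    qed
  qed
  then have "exchange n M" unfolding exchange_def by blast
  moreover have "0 \<notin> M"
    using golod[OF permutes_id] unfolding d_golod_mspan_iff[OF M permutes_id] by blast
  ultimately show "0 \<notin> M \<and> exchange n M" by blast
next
  assume M0: "0 \<notin> M \<and> exchange n M"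
  have "a + b \<in> M" if \<sigma>: "\<sigma> permutes {1..n}" and ab: "a \<in> d_expos n \<sigma> M" "b \<in> d_expos n \<sigma> M" for \<sigma> a b
  proof -
    obtain i j where "i \<in> {1..n}" "j \<in> {1..n}" "a + xvec (\<sigma> i) \<in> M" "b + xvec (\<sigma> j) \<in> M"
      using ab unfolding d_expos_def by blast
    then show ?thesis
      using M0 permutes_in_image[OF \<sigma>] by (intro exchangeD[of n M a "\<sigma> i" b "\<sigma> j"]) auto
  qed
  then show "strongly_d_golod n S (mspan M)"
    using M0 by (auto simp: strongly_d_golod_def d_golod_mspan_iff[OF M])
qed

text \<open>Exchange in \<open>M\<close> is applied to \<open>a + xvec i + u\<close> and
  \<open>b + xvec j + v\<close> with \<open>u\<close> and \<open>v\<close> from \<open>N\<close>.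
  This uses one multiplier for each factor, so it only places \<open>a + b\<close> in the colon by
  \<open>N + N\<close>; the stability hypothesis closes the gap.\<close>

lemma exchange_colonset:
  assumes ex: "exchange n M" and stable: "colonset M (N + N) \<subseteq> colonset M N"
  shows "exchange n (colonset M N)"
  unfolding exchange_def
proof (intro allI ballI impI)
  fix a b i j assume ij: "i \<in> {1..n}" "j \<in> {1..n}"
    and ab: "a + xvec i \<in> colonset M N" "b + xvec j \<in> colonset M N"
  have "a + b + w \<in> M" if "w \<in> N + N" for w
  proof -
    from that obtain u v where w: "w = u + v" "u \<in> N" "v \<in> N" by (rule set_plus_elim)
    then have "a + xvec i + u \<in> M" "b + xvec j + v \<in> M" using ab by (auto simp: colonset_def)
    then have "(a + u) + xvec i \<in> M" "(b + v) + xvec j \<in> M" by (simp_all add: ac_simps)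
    then have "(a + u) + (b + v) \<in> M" by (rule exchangeD[OF ex _ _ ij])
    then show ?thesis by (simp add: w ac_simps)
  qed
  then have "a + b \<in> colonset M (N + N)"
    using ab by (simp add: colonset_def expos_add_iff)
  then show "a + b \<in> colonset M N" using stable by blast
qed

text \<open>The variable divides one of the \<open>Suc k\<close> factors. What is left of that
  factor serves as a multiplier of the other \<open>k\<close> factors.\<close>

lemma powset_remove_var:
  assumes M: "upset n M"
  shows "m + xvec i \<in> powset M (Suc k) \<Longrightarrow> m \<in> powset M k"
proof (induction k arbitrary: m)
  case 0
  then show ?case using expos_plus_upset[OF M] upsetD[OF M] expos_add_iff by simp blast
next
  case (Suc k)
  obtain a b where ab: "m + xvec i = a + b" "a \<in> powset M (Suc k)" "b \<in> M"
    using Suc.prems set_plus_elim[of "m + xvec i" "powset M (Suc k)" M] by auto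
  have "i \<in> Poly_Mapping.keys (m + xvec i)" by (simp add: keys_add_nat xvec_def)
  then consider "i \<in> Poly_Mapping.keys a" | "i \<in> Poly_Mapping.keys b"
    unfolding ab(1) keys_add_nat by blast
  then show ?case
  proof cases
    case 1
    then obtain c where c: "a = xvec i + c" by (rule keys_xvec_decomp)
    then have "c \<in> powset M k" using Suc.IH[of c] ab(2) by (simp add: add.commute)
    moreover have "m + xvec i = (c + b) + xvec i" using ab(1) by (simp only: c ac_simps)
    then have "m = c + b" by (simp only: add_right_cancel)
    ultimately show ?thesis using ab(3) by (auto intro: set_plus_intro)
  next
    case 2
    then obtain c where c: "b = xvec i + c" by (rule keys_xvec_decomp)
    then have "c \<in> expos n" using upsetD[OF M ab(3)] by (simp add: expos_add_iff)
    moreover have "m + xvec i = (a + c) + xvec i" using ab(1) by (simp only: c ac_simps)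
    then have "m = a + c" by (simp only: add_right_cancel)
    ultimately show ?thesis using upset_add[OF upset_powset[OF M] ab(2)] by simp
  qed
qed

lemma exchange_powset:
  assumes M: "upset n M" and k: "2 \<le> k"
  shows "exchange n (powset M k)"
  unfolding exchange_def
proof (intro allI ballI impI)
  fix a b i j assume ab: "a + xvec i \<in> powset M k" "b + xvec j \<in> powset M k"
  obtain l where l: "k = Suc l" using k by (cases k) auto
  have "a \<in> powset M l" "b \<in> powset M l"
    using ab powset_remove_var[OF M] unfolding l by blast+
  then have "a + b \<in> powset M (l + l)" by (simp add: powset_add[OF M] set_plus_intro)
  \<comment> \<open>This is 2(k - 1) \<ge> k, the place where \<open>k \<ge> 2\<close>
    enters.\<close>
  moreover have "k \<le> l + l" using k l by simp
  ultimately show "a + b \<in> powset M k" using powset_antimono[OF M] by blast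
qed

end

section \<open>Associated primes, saturations and symbolic powers\<close>

context series_ring
begin

lemma prime_monomial:
  assumes P: "primeideal P S"
  shows "m \<in> expos n \<Longrightarrow> monomial m \<in> P \<Longrightarrow> \<exists>i\<in>Poly_Mapping.keys m. monomial (xvec i) \<in> P"
proof (induction "expo_degree m" arbitrary: m rule: less_induct)
  case less
  interpret P: primeideal P S by (rule P)
  show ?case
  proof (cases "m = 0")
    case True
    then have "\<one> \<in> P" using less.prems by (simp add: ops)
    then show ?thesis using P.one_imp_carrier P.I_notcarr by simp
  next
    case False
    then have "Poly_Mapping.keys m \<noteq> {}" by simp
    then obtain i where i: "i \<in> Poly_Mapping.keys m" by blast
    then obtain b where m: "m = xvec i + b" by (rule keys_xvec_decomp)
    have "monomial (xvec i) \<otimes> monomial b \<in> P" "xvec i \<in> expos n" "b \<in> expos n"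
      using less.prems by (simp_all add: m monomial_mult expos_add_iff)
    then have "monomial (xvec i) \<in> P \<or> monomial b \<in> P"
      by (intro P.I_prime) simp_all
    then show ?thesis
    proof
      assume "monomial b \<in> P"
      moreover have "expo_degree b < expo_degree m"
        by (simp add: m expo_degree_add expo_degree_xvec)
      ultimately have "\<exists>i\<in>Poly_Mapping.keys b. monomial (xvec i) \<in> P"
        using \<open>b \<in> expos n\<close> by (intro less.hyps)
      then show ?thesis by (auto simp: m keys_add_nat)
    qed (use i in blast)
  qed
qed

lemma monomial_mult_mspan:
  assumes "d \<in> expos n" "f \<in> carrier S" "\<And>m. f m \<noteq> 0 \<Longrightarrow> m + d \<in> M"
  shows "monomial d \<otimes> f \<in> mspan M"
proof -
  have "m \<in> M" if "series_mult (monomial d) f m \<noteq> 0" for m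
    using that
  proof (rule series_mult_nonzeroE)
    fix a b assume "m = a + b" "monomial d a \<noteq> (0::'k)" "f b \<noteq> 0"
    then show ?thesis using assms(3)[of b] by (simp add: monomial_def add.commute split: if_splits)
  qed
  moreover have "monomial d \<otimes> f \<in> carrier S" using assms(1,2) by simp
  ultimately show ?thesis by (simp add: mspan_def ops)
qed

text \<open>A common denominator: each of the finitely many Dickson generators of the localization
  at \<open>W\<close> has its own multiplier in \<open>W\<close>, and the sum of these exponents
  works for all of them.\<close>

lemma localization_witness:
  assumes M: "upset n M" and W: "0 \<in> W" "\<And>d e. d \<in> W \<Longrightarrow> e \<in> W \<Longrightarrow> d + e \<in> W" "W \<subseteq> expos n"
  obtains d where "d \<in> W" "\<And>m e. m \<in> expos n \<Longrightarrow> e \<in> W \<Longrightarrow> m + e \<in> M \<Longrightarrow> m + d \<in> M"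
proof -
  define X where "X = {m \<in> expos n. \<exists>e\<in>W. m + e \<in> M}"
  have X: "X \<subseteq> expos n" by (auto simp: X_def)
  obtain B where B: "B \<subseteq> X" "finite B" "\<And>m. m \<in> X \<Longrightarrow> \<exists>b\<in>B. \<exists>d\<in>expos n. m = b + d"
    using expo_dickson[OF X] by metis
  have "\<forall>b\<in>B. \<exists>e\<in>W. b + e \<in> M" using B(1) by (auto simp: X_def)
  then obtain e where e: "\<And>b. b \<in> B \<Longrightarrow> e b \<in> W" "\<And>b. b \<in> B \<Longrightarrow> b + e b \<in> M" by metis
  have sumW: "sum e F \<in> W" if "finite F" "F \<subseteq> B" for F
    using that by (induction F rule: finite_induct) (simp_all add: W e(1))
  show ?thesis
  proof (rule that[of "sum e B"])
    show "sum e B \<in> W" using sumW B(2) by blast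
    fix m w assume "m \<in> expos n" "w \<in> W" "m + w \<in> M"
    then have "m \<in> X" by (auto simp: X_def)
    then obtain b c where b: "b \<in> B" "c \<in> expos n" "m = b + c" using B(3)[of m] by blast
    have "sum e B = e b + sum e (B - {b})" by (rule sum.remove[OF B(2) b(1)])
    then have eq: "m + sum e B = (b + e b) + (c + sum e (B - {b}))"
      by (simp only: b(3) ac_simps)
    have "sum e (B - {b}) \<in> W" using B(2) by (intro sumW) auto
    then show "m + sum e B \<in> M"
      unfolding eq using b(2) W(3) by (intro upset_add[OF M e(2)[OF b(1)]]) (auto simp: expos_add_iff)
  qed
qed

text \<open>If \<open>P = I : a\<close> contains exactly the variables \<open>x\<^sub>i\<close>, \<open>i \<in> A\<close>, then \<open>I\<close> may be replaced by its
  localization at the other variables, on which these act as nonzerodivisors.  An element of \<open>P\<close>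
  with a term free of the variables in \<open>A\<close> then contradicts \<open>P a \<subseteq> I\<close> at the product of the least
  terms.\<close>

lemma associated_prime_mspan:
  assumes M: "upset n M" and P: "primeideal P S" and a: "a \<in> carrier S"
    and Pa: "P = {b \<in> carrier S. b \<otimes> a \<in> mspan M}"
  obtains Q where "upset n Q" "P = mspan Q"
proof -
  interpret P: primeideal P S by (rule P)
  \<comment> \<open>\<open>Q\<close> belongs to the ideal generated by the variables in
    \<open>P\<close>, \<open>W\<close> to the monomials in the other variables, and
    \<open>M'\<close> to the localization of \<open>M\<close> at \<open>W\<close>, contracted
    back.\<close>
  define Q where "Q = {m \<in> expos n. \<exists>i\<in>Poly_Mapping.keys m. monomial (xvec i) \<in> P}"
  define W where "W = expos n - Q"
  define M' where "M' = {m \<in> expos n. \<exists>d\<in>W. m + d \<in> M}"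
  have Q: "upset n Q" by (auto simp: upset_def Q_def expos_add_iff keys_add_nat)
  have W: "0 \<in> W" "\<And>d e. d \<in> W \<Longrightarrow> e \<in> W \<Longrightarrow> d + e \<in> W" "W \<subseteq> expos n"
    by (auto simp: W_def Q_def expos_add_iff keys_add_nat)
  have QP: "mspan Q \<subseteq> P"
  proof (rule mspan_subset_ideal[OF P.is_ideal upset_subset[OF Q]])
    fix m assume "m \<in> Q"
    then obtain i where i: "m \<in> expos n" "i \<in> Poly_Mapping.keys m" "monomial (xvec i) \<in> P"
      by (auto simp: Q_def)
    from i(2) obtain b where m: "m = xvec i + b" by (rule keys_xvec_decomp)
    then have "monomial (xvec i) \<otimes> monomial b \<in> P"
      using i(1,3) by (intro P.I_r_closed) (simp_all add: expos_add_iff)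
    then show "monomial m \<in> P" by (simp add: m monomial_mult)
  qed
  obtain d where d: "d \<in> W" "\<And>m e. m \<in> expos n \<Longrightarrow> e \<in> W \<Longrightarrow> m + e \<in> M \<Longrightarrow> m + d \<in> M"
    using localization_witness[OF M W] by metis
  have M'_cancel: "m \<in> M'" if "m \<in> expos n" "e \<in> W" "e + m \<in> M'" for m e
  proof -
    obtain f where f: "f \<in> W" "(e + m) + f \<in> M" using \<open>e + m \<in> M'\<close> by (auto simp: M'_def)
    then have "m + (e + f) \<in> M" by (simp add: ac_simps)
    then show ?thesis using that f(1) W(2) by (auto simp: M'_def)
  qed
  have M'_add: "e + m \<in> M'" if "m \<in> M'" "e \<in> expos n" for m e
  proof -
    obtain f where f: "f \<in> W" "m + f \<in> M" using \<open>m \<in> M'\<close> by (auto simp: M'_def)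
    then have "(e + m) + f \<in> M" using upset_add'[OF M f(2) that(2)] by (simp add: ac_simps)
    then show ?thesis using that f(1) by (auto simp: M'_def expos_add_iff)
  qed
  let ?X = "{m. a m \<noteq> 0 \<and> m \<notin> M'}"
  \<comment> \<open>Otherwise the common denominator \<open>d\<close> multiplies all of
    \<open>a\<close> into the ideal, so its monomial lies in \<open>P\<close>. Then some variable of
    \<open>d\<close> lies in \<open>P\<close>, against \<open>d \<in> W\<close>.\<close>
  have "?X \<noteq> {}"
  proof
    assume "?X = {}"
    then have "m + d \<in> M" if "a m \<noteq> 0" for m
      using that d(2) by (auto simp: M'_def)
    then have "monomial d \<otimes> a \<in> mspan M"
      using d(1) W(3) a by (intro monomial_mult_mspan) auto
    moreover have "monomial d \<in> carrier S" using d(1) W(3) by auto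
    ultimately have "monomial d \<in> P" unfolding Pa by blast
    then obtain i where "i \<in> Poly_Mapping.keys d" "monomial (xvec i) \<in> P"
      using prime_monomial[OF P, of d] d(1) W(3) by blast
    then show False using d(1) unfolding W_def Q_def by blast
  qed
  moreover have "?X \<subseteq> expos n" using supp_expos[OF a] by blast
  ultimately obtain x where x: "x \<in> ?X" "\<And>m. m \<in> ?X \<Longrightarrow> x \<le> m"
    using expo_lex_least[of ?X n] by blast
  have "P \<subseteq> mspan Q"
  proof (rule subsetI, rule ccontr)
    fix b assume b: "b \<in> P" and bQ: "b \<notin> mspan Q"
    have bc: "b \<in> carrier S" using b P.Icarr by blast
    let ?Y = "{m. b m \<noteq> 0 \<and> m \<notin> Q}"
    \<comment> \<open>Discarding the terms of \<open>b\<close> in \<open>Q\<close> changes it by an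
      element of \<open>mspan Q \<subseteq> P\<close>, so \<open>b1\<close> still multiplies
      \<open>a\<close> into the ideal.\<close>
    define b1 where "b1 = (\<lambda>m. if m \<notin> Q then b m else 0)"
    define b2 where "b2 = (\<lambda>m. if m \<in> Q then b m else 0)"
    have b1c: "b1 \<in> carrier S" unfolding b1_def by (rule cut_closed[OF bc])
    have b2c: "b2 \<in> carrier S" unfolding b2_def by (rule cut_closed[OF bc])
    have "b2 \<in> mspan Q" using b2c by (simp add: mspan_def) (simp add: b2_def)
    then have "b2 \<in> P" using QP by blast
    moreover have "b1 \<oplus> b2 = b" by (auto simp: ops b1_def b2_def)
    moreover have "b1 = (b1 \<oplus> b2) \<ominus> b2" using b1c b2c by (simp add: a_minus_def a_assoc r_neg)
    ultimately have "b1 \<in> P" using b P.a_closed P.a_inv_closed unfolding a_minus_def by metis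
    then have ba: "b1 \<otimes> a \<in> mspan M" unfolding Pa by blast
    have "?Y \<noteq> {}" using bQ bc by (auto simp: mspan_def)
    moreover have "?Y \<subseteq> expos n" using supp_expos[OF bc] by blast
    ultimately obtain y where y: "y \<in> ?Y" "\<And>m. m \<in> ?Y \<Longrightarrow> y \<le> m"
      using expo_lex_least[of ?Y n] by blast
    have yW: "y \<in> W" using y(1) supp_expos[OF bc] unfolding W_def by blast
    have xE: "x \<in> expos n" using x(1) supp_expos[OF a] by blast
    have xy: "y + x \<notin> M'" using M'_cancel[OF xE yW] x(1) by auto
    \<comment> \<open>Only the pair of least terms contributes. A term \<open>v\<close> of
      \<open>a\<close> inside \<open>M'\<close> would force \<open>y + x \<in> M'\<close>; all other
      terms satisfy \<open>y \<le> u\<close> and \<open>x \<le> v\<close>, so their sum exceeds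
      \<open>y + x\<close> unless both are equalities.\<close>
    have "series_mult b1 a (y + x) = (\<Sum>p\<in>{(y, x)}. b1 (fst p) * a (snd p))"
      unfolding series_mult_alt
    proof (rule sum.mono_neutral_right[OF finite_decomp'])
      show "\<forall>p\<in>{p. fst p + snd p = y + x} - {(y, x)}. b1 (fst p) * a (snd p) = 0"
      proof (rule ballI, rule ccontr)
        fix p assume p: "p \<in> {p. fst p + snd p = y + x} - {(y, x)}" "b1 (fst p) * a (snd p) \<noteq> 0"
        obtain u v where "p = (u, v)" by (cases p)
        then have uv: "u + v = y + x" "(u, v) \<noteq> (y, x)" and nz: "b u \<noteq> 0" "u \<notin> Q" "a v \<noteq> 0"
          using p by (auto simp: b1_def split: if_splits)
        have "y \<le> u" using y(2) nz by blast
        moreover have "v \<notin> M'"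
          using M'_add[of v u] supp_expos[OF bc nz(1)] uv(1) xy by metis
        then have "x \<le> v" using x(2) nz(3) by blast
        ultimately have "y + x < u + v"
          using uv(2) by (metis add_less_le_mono add_le_less_mono order_le_less)
        then show False using uv(1) by simp
      qed
    qed simp
    also have "\<dots> \<noteq> 0" using x(1) y(1) by (simp add: b1_def)
    finally have "y + x \<in> M" using ba by (auto simp: mspan_def ops)
    then have "y + x \<in> M'" using W(1) upsetD[OF M] by (auto simp: M'_def intro!: bexI[of _ 0])
    then show False using xy by blast
  qed
  then show ?thesis using that[OF Q] QP by blast
qed

text \<open>The empty family is included: it yields the unit ideal, the case without embedded
  primes.\<close>

lemma Inter_mspan:
  assumes "\<And>P. P \<in> F \<Longrightarrow> \<exists>Q. upset n Q \<and> P = mspan Q"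
  shows "\<exists>Q. upset n Q \<and> carrier S \<inter> \<Inter>F = mspan Q"
proof -
  define G where "G = {Q. upset n Q \<and> mspan Q \<in> F}"
  have F: "F = mspan ` G" using assms by (auto simp: G_def)
  have "upset n (expos n \<inter> \<Inter>G)" by (auto simp: upset_def G_def expos_add_iff)
  moreover have "carrier S \<inter> \<Inter>F = mspan (expos n \<inter> \<Inter>G)"
    unfolding F using supp_expos by (auto simp: mspan_def)
  ultimately show ?thesis by blast
qed

lemma strongly_d_golod_saturation:
  assumes M: "upset n M" "exchange n M" and N: "upset n N"
    and proper: "saturation S (mspan M) (mspan N) \<noteq> carrier S"
  shows "strongly_d_golod n S (saturation S (mspan M) (mspan N))"
proof -
  obtain T where T: "saturation S (mspan M) (mspan N) = mspan (colonset M (powset N T))"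
    "\<And>t. colonset M (powset N t) \<subseteq> colonset M (powset N T)"
    using saturation_mspan[OF M(1) N] by blast
  \<comment> \<open>The square of the \<open>T\<close>-th power is the power \<open>T + T\<close>,
    so maximality of the colon at \<open>T\<close> is exactly the required stability.\<close>
  have "exchange n (colonset M (powset N T))"
    using T(2)[of "T + T"] by (intro exchange_colonset[OF M(2)]) (simp add: powset_add[OF N])
  then show ?thesis
    using proper upset_colonset[OF M(1)] unfolding T(1)
    by (simp add: strongly_d_golod_mspan_iff mspan_eq_carrier_iff)
qed

lemma strongly_d_golod_symbolic_power:
  assumes M: "upset n M" and k: "2 \<le> k" and proper: "symbolic_power S (mspan M) k \<noteq> carrier S"
  shows "strongly_d_golod n S (symbolic_power S (mspan M) k)"
proof -
  let ?I = "mspan (powset M k)"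
  have I: "ideal_power S (mspan M) k = ?I" by (rule ideal_power_mspan[OF M])
  define F where "F = associated_primes S ?I - minimal_primes S ?I"
  have F: "\<exists>Q. upset n Q \<and> P = mspan Q" if P: "P \<in> F" for P
  proof -
    obtain a where a: "primeideal P S" "a \<in> carrier S" "P = {b \<in> carrier S. b \<otimes> a \<in> ?I}"
      using P unfolding F_def associated_primes_def by blast
    show ?thesis by (rule associated_prime_mspan[OF upset_powset[OF M] a]) blast
  qed
  have "\<exists>Q. upset n Q \<and> carrier S \<inter> \<Inter>F = mspan Q"
    by (rule Inter_mspan[OF F])
  then obtain Q where Q: "upset n Q" "carrier S \<inter> \<Inter>F = mspan Q"
    by (elim exE conjE)
  have "symbolic_power S (mspan M) k = saturation S ?I (mspan Q)"
    using Q(2) by (simp only: symbolic_power_def I F_def)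
  then show ?thesis
    using proper strongly_d_golod_saturation[OF upset_powset[OF M] exchange_powset[OF M k] Q(1)] by simp
qed

end

section \<open>Arbitrary ideals\<close>

lemma expo_add_eq_0 [simp]: "a + b = (0 :: expo) \<longleftrightarrow> a = 0 \<and> b = 0"
  using expo_degree_add[of a b] by (metis add_is_0 expo_degree_eq_0 add_0)

lemma expo_degree_pos: "0 < expo_degree m \<longleftrightarrow> m \<noteq> 0"
  by (simp add: zero_less_iff_neq_zero)

lemma series_mult_0: "series_mult f g 0 = f 0 * g 0"
proof -
  have "{x. fst x + snd x = (0 :: expo)} = {(0, 0)}" by auto
  then show ?thesis by (simp add: series_mult_alt)
qed

lemma homogeneous_part_0: "homogeneous_part 0 f = (\<lambda>m. if m = 0 then f 0 else 0)"
  by (auto simp: homogeneous_part_def)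

text \<open>The recursion solves f g = 1 for one coefficient of g at a time. The pair
  \<open>(0, m)\<close> is left out of the sum, so the recursive calls are at exponents of smaller
  degree.\<close>

function series_inverse :: "'k::field series \<Rightarrow> 'k series" where
  "series_inverse f m = (if m = 0 then inverse (f 0) else
     - inverse (f 0) * (\<Sum>x\<in>{x. fst x + snd x = m \<and> fst x \<noteq> 0}. f (fst x) * series_inverse f (snd x)))"
  by pat_completeness auto
termination
  by (relation "measure (\<lambda>(f, m). expo_degree m)") (auto simp: expo_degree_add expo_degree_pos)

declare series_inverse.simps [simp del]

lemma series_mult_inverse:
  assumes "f 0 \<noteq> 0"
  shows "series_mult f (series_inverse f) = monomial 0"
proof
  fix m
  show "series_mult f (series_inverse f) m = monomial 0 m"
  proof (cases "m = 0")
    case True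
    then show ?thesis using assms by (simp add: series_mult_0 monomial_def series_inverse.simps)
  next
    case False
    let ?g = "\<lambda>x. f (fst x) * series_inverse f (snd x)"
    let ?A = "{x. fst x + snd x = m \<and> fst x \<noteq> 0}"
    have "{x. fst x + snd x = m} = insert (0, m) ?A" by auto
    moreover have "finite ?A" using finite_decomp'[of m] by (rule rev_finite_subset) auto
    ultimately have "series_mult f (series_inverse f) m = ?g (0, m) + sum ?g ?A"
      unfolding series_mult_alt by simp
    also have "?g (0, m) = - sum ?g ?A"
      using False assms by (simp add: series_inverse.simps[of f m])
    finally show ?thesis using False by (simp add: monomial_def)
  qed
qed

lemma series_inverse_expos:
  assumes "\<And>m. f m \<noteq> 0 \<Longrightarrow> m \<in> expos n"
  shows "series_inverse f m \<noteq> 0 \<Longrightarrow> m \<in> expos n"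
proof (induction "expo_degree m" arbitrary: m rule: less_induct)
  case less
  show ?case
  proof (cases "m = 0")
    case False
    let ?A = "{x. fst x + snd x = m \<and> fst x \<noteq> 0}"
    have "sum (\<lambda>x. f (fst x) * series_inverse f (snd x)) ?A \<noteq> 0"
      using less.prems False by (auto simp: series_inverse.simps[of f m])
    then obtain x where x: "x \<in> ?A" "f (fst x) * series_inverse f (snd x) \<noteq> 0"
      by (rule sum.not_neutral_contains_not_neutral)
    then have m: "m = fst x + snd x" "fst x \<noteq> 0" by auto
    then have "expo_degree (snd x) < expo_degree m" by (simp add: expo_degree_add expo_degree_pos)
    then have "snd x \<in> expos n" using x(2) by (intro less.hyps) auto
    moreover have "fst x \<in> expos n" using x(2) assms by auto
    ultimately show ?thesis by (simp add: m expos_add_iff)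
  qed simp
qed

text \<open>The evaluation at 0 of the variables x_k with \<open>k\<close> among \<sigma> 1, ...,
  \<sigma> (r - 1). It supplies the cofactors in the product rule
  \<open>d_perm_mult\<close>.\<close>

definition v_perm :: "(nat \<Rightarrow> nat) \<Rightarrow> nat \<Rightarrow> 'k::field series \<Rightarrow> 'k series"
  where "v_perm \<sigma> r f = permute_vars \<sigma> (vanish_below r (permute_vars (inv_into UNIV \<sigma>) f))"

context series_ring
begin

text \<open>A nonzero constant term would put a unit into \<open>I\<close>: for polynomials the
  degree 0 component, which a graded ideal contains, and for power series \<open>f\<close>
  itself.\<close>

lemma proper_constant_term:
  assumes I: "ideal I S" "I \<noteq> carrier S" and gr: "S = polynomial_ring n \<Longrightarrow> graded I" and f: "f \<in> I"
  shows "f 0 = 0"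
proof (rule ccontr)
  assume f0: "f 0 \<noteq> 0"
  interpret I: ideal I S by (rule I)
  have fc: "f \<in> carrier S" using f I.Icarr by blast
  have "\<one> \<in> I"
  proof (cases "S = polynomial_ring n")
    case True
    let ?h = "homogeneous_part 0 f" and ?c = "\<lambda>m. if m = 0 then inverse (f 0) else 0"
    have "?h \<in> I" using gr[OF True] f by (simp add: graded_def)
    moreover have "?c \<in> carrier S"
      by (rule carrier_mono[OF one_closed]) (auto simp: ops monomial_def split: if_splits)
    ultimately have "?h \<otimes> ?c \<in> I" by (rule I.I_r_closed)
    also have "?h \<otimes> ?c = \<one>"
    proof
      fix m
      show "(?h \<otimes> ?c) m = \<one> m"
      proof (cases "m = 0")
        case True
        then show ?thesis using f0 by (simp add: ops series_mult_0 homogeneous_part_0 monomial_def)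
      next
        case False
        have "series_mult ?h ?c m = 0"
        proof (rule ccontr)
          assume "series_mult ?h ?c m \<noteq> 0"
          then show False
            by (rule series_mult_nonzeroE) (use False in \<open>auto simp: homogeneous_part_0 split: if_splits\<close>)
        qed
        then show ?thesis using False by (simp add: ops monomial_def)
      qed
    qed
    finally show ?thesis .
  next
    case False
    then have "S = power_series_ring n" using S by blast
    then have "series_inverse f \<in> carrier S"
      using series_inverse_expos[of f n] supp_expos[OF fc]
      by (simp add: power_series_ring_def expos_def)
    then have "f \<otimes> series_inverse f \<in> I" by (intro I.I_r_closed f)
    then show ?thesis using series_mult_inverse[of f] f0 by (simp add: ops)
  qed
  then show False using I.one_imp_carrier I(2) by blast
qed

section \<open>The product rule and its cofactors\<close>

lemma d_perm_add: "d_perm \<sigma> i (f \<oplus> g) = d_perm \<sigma> i f \<oplus> d_perm \<sigma> i g"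
  by (simp add: ops d_perm_def permute_vars_add d_op_add)

lemma d_perm_mult:
  assumes "\<sigma> permutes {1..n}"
  shows "d_perm \<sigma> i (f \<otimes> g) =
    d_perm \<sigma> i f \<otimes> v_perm \<sigma> i g \<oplus> v_perm \<sigma> (Suc i) f \<otimes> d_perm \<sigma> i g"
  by (simp add: ops d_perm_def v_perm_def permute_vars_add permute_vars_mult d_op_mult
      permutes_bij[OF assms] permutes_bij[OF permutes_inv[OF assms]])

text \<open>Descending induction on \<open>r\<close>. At \<open>Suc n\<close> all variables are set
  to 0 and only the vanishing constant term remains; each step down adds a variable times
  \<open>d_perm \<sigma> r f\<close>, which lies in \<open>D\<close>.\<close>

lemma v_perm_in_ideal:
  assumes \<sigma>: "\<sigma> permutes {1..n}" and D: "ideal D S" "\<And>i. i \<in> {1..n} \<Longrightarrow> d_perm \<sigma> i f \<in> D"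
    and f: "f \<in> carrier S" "f 0 = 0" and r: "1 \<le> r" "r \<le> Suc n"
  shows "v_perm \<sigma> r f \<in> D"
  using r(2,1)
proof (induction r rule: inc_induct)
  interpret D: ideal D S by (rule D)
  let ?q = "permute_vars (inv_into UNIV \<sigma>) f"
  have \<rho>: "inv_into UNIV \<sigma> permutes {1..n}" by (rule permutes_inv[OF \<sigma>])
  {
    case base
    have qc: "?q \<in> carrier S" by (rule permute_vars_closed[OF S f(1) \<rho>])
    have "?q 0 = 0" using f(2) by (simp add: permute_vars_def map_key_zero permutes_inj[OF \<rho>])
    have "vanish_below (Suc n) ?q m = 0" for m
    proof (rule ccontr)
      assume "vanish_below (Suc n) ?q m \<noteq> 0"
      then have k: "Poly_Mapping.keys m \<subseteq> {Suc n..}" "?q m \<noteq> 0"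
        by (auto simp: vanish_below_def split: if_splits)
      have "Poly_Mapping.keys m \<subseteq> {1..n}" by (rule series_ring_keys[OF S qc k(2)])
      with k(1) have "Poly_Mapping.keys m = {}" by fastforce
      then show False using k(2) \<open>?q 0 = 0\<close> by simp
    qed
    then have "v_perm \<sigma> (Suc n) f = \<zero>" by (simp add: v_perm_def ops permute_vars_def)
    then show ?case by simp
  next
    case (step r)
    have r: "r \<in> {1..n}" using step by auto
    have "vanish_below r ?q =
        (\<lambda>m. series_mult (monomial (xvec r)) (d_op r ?q) m + vanish_below (Suc r) ?q m)"
      by (simp add: xvec_d_op)
    then have "v_perm \<sigma> r f = permute_vars \<sigma> (monomial (xvec r)) \<otimes> d_perm \<sigma> r f \<oplus> v_perm \<sigma> (Suc r) f"
      by (simp add: v_perm_def d_perm_def permute_vars_add permute_vars_mult[OF permutes_bij[OF \<sigma>]] ops)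
    moreover have "permute_vars \<sigma> (monomial (xvec r)) \<in> carrier S"
      using r by (intro permute_vars_closed[OF S _ \<sigma>]) simp
    ultimately show ?case using D(2)[OF r] step by (simp add: D.I_l_closed)
  }
qed

text \<open>Each summand of the product rule pairs an operator value of one factor with a truncation
  of the other, and by \<open>v_perm_in_ideal\<close> the truncations lie in the d_\<sigma> ideals
  too.\<close>

lemma d_perm_ideal_prod:
  assumes \<sigma>: "\<sigma> permutes {1..n}" and I: "ideal I S" "\<forall>f\<in>I. f 0 = 0"
    and J: "ideal J S" "\<forall>f\<in>J. f 0 = 0" and i: "i \<in> {1..n}" and h: "h \<in> I \<cdot> J"
  shows "d_perm \<sigma> i h \<in> d_ideal n S \<sigma> I \<cdot> d_ideal n S \<sigma> J"
  using h
proof induction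
  have v: "v_perm \<sigma> r f \<in> d_ideal n S \<sigma> L"
    if L: "ideal L S" "\<forall>f\<in>L. f 0 = 0" and f: "f \<in> L" and r: "1 \<le> r" "r \<le> Suc n" for L f r
  proof -
    have "L \<subseteq> carrier S" using ideal.Icarr[OF L(1)] by blast
    then show ?thesis
      using f r L(2) by (intro v_perm_in_ideal[OF \<sigma> ideal_d_ideal[OF \<sigma>]] d_perm_in_d_ideal[OF \<sigma>]) auto
  qed
  have d: "d_perm \<sigma> i f \<in> d_ideal n S \<sigma> L" if "ideal L S" "f \<in> L" for L f
    using that i ideal.Icarr[OF that(1)] by (intro d_perm_in_d_ideal[OF \<sigma>]) auto
  case (prod f g)
  have "d_perm \<sigma> i f \<in> d_ideal n S \<sigma> I" "d_perm \<sigma> i g \<in> d_ideal n S \<sigma> J"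
    using prod I(1) J(1) by (auto intro: d)
  moreover have "v_perm \<sigma> i g \<in> d_ideal n S \<sigma> J"
    using prod J i by (intro v[of J]) auto
  moreover have "v_perm \<sigma> (Suc i) f \<in> d_ideal n S \<sigma> I"
    using prod I i by (intro v[of I]) auto
  ultimately show ?case
    unfolding d_perm_mult[OF \<sigma>] by (intro ideal_prod.sum ideal_prod.prod)
next
  case (sum f g)
  then show ?case unfolding d_perm_add by (intro ideal_prod.sum)
qed

lemma d_golodD:
  assumes "d_golod n S \<sigma> I" and \<sigma>: "\<sigma> permutes {1..n}"
  shows "ideal I S" "I \<noteq> carrier S" "S = polynomial_ring n \<Longrightarrow> graded I" "\<forall>f\<in>I. f 0 = 0"
    "I \<subseteq> carrier S" "ideal (d_ideal n S \<sigma> I) S"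
    "\<And>f g. f \<in> d_ideal n S \<sigma> I \<Longrightarrow> g \<in> d_ideal n S \<sigma> I \<Longrightarrow> f \<otimes> g \<in> I"
proof -
  show I: "ideal I S" "I \<noteq> carrier S" and gr: "S = polynomial_ring n \<Longrightarrow> graded I"
    using assms by (auto simp: d_golod_def)
  show "\<forall>f\<in>I. f 0 = 0" using proper_constant_term[OF I gr] by blast
  show carr: "I \<subseteq> carrier S" using ideal.Icarr[OF I(1)] by blast
  show D: "ideal (d_ideal n S \<sigma> I) S" by (rule ideal_d_ideal[OF \<sigma> carr])
  show "f \<otimes> g \<in> I" if "f \<in> d_ideal n S \<sigma> I" "g \<in> d_ideal n S \<sigma> I" for f g
    using assms(1) ideal_prod.prod[OF that, of S] unfolding d_golod_def ideal_power_2[OF D] by blast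
qed

text \<open>The square is tested on any ideal \<open>D\<close> above d_\<sigma>(I). For
  intersections, products and sums, \<open>D\<close> is the intersection, product or sum of the two
  d_\<sigma> ideals.\<close>

lemma d_golodI:
  assumes "ideal I S" "I \<noteq> carrier S" "S = polynomial_ring n \<Longrightarrow> graded I" and \<sigma>: "\<sigma> permutes {1..n}"
    and D: "ideal D S" "\<And>i f. i \<in> {1..n} \<Longrightarrow> f \<in> I \<Longrightarrow> d_perm \<sigma> i f \<in> D"
    and sq: "\<And>f g. f \<in> D \<Longrightarrow> g \<in> D \<Longrightarrow> f \<otimes> g \<in> I"
  shows "d_golod n S \<sigma> I"
proof -
  have sub: "d_ideal n S \<sigma> I \<subseteq> D" by (rule d_ideal_minimal[OF D])
  have "I \<subseteq> carrier S" using ideal.Icarr[OF assms(1)] by blast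
  then have "ideal_power S (d_ideal n S \<sigma> I) 2 \<subseteq> I"
    using sub sq by (intro ideal_power_2_subset assms(1) ideal_d_ideal[OF \<sigma>]) blast+
  then show ?thesis using assms(1-3) unfolding d_golod_def by blast
qed

section \<open>Intersections, products and sums of Golod ideals\<close>

lemma d_golod_Int:
  assumes \<sigma>: "\<sigma> permutes {1..n}" and "d_golod n S \<sigma> I" "d_golod n S \<sigma> J"
  shows "d_golod n S \<sigma> (I \<inter> J)"
proof -
  note I = d_golodD[OF assms(2) \<sigma>] and J = d_golodD[OF assms(3) \<sigma>]
  show ?thesis
  proof (rule d_golodI[OF _ _ _ \<sigma>])
    show "ideal (I \<inter> J) S" by (rule i_intersect[OF I(1) J(1)])
    show "I \<inter> J \<noteq> carrier S" using I(2,5) by blast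
    show "graded (I \<inter> J)" if "S = polynomial_ring n"
      using I(3)[OF that] J(3)[OF that] unfolding graded_def by blast
    show "ideal (d_ideal n S \<sigma> I \<inter> d_ideal n S \<sigma> J) S" by (rule i_intersect[OF I(6) J(6)])
    show "d_perm \<sigma> i f \<in> d_ideal n S \<sigma> I \<inter> d_ideal n S \<sigma> J" if "i \<in> {1..n}" "f \<in> I \<inter> J" for i f
      using that d_perm_in_d_ideal[OF \<sigma> I(5)] d_perm_in_d_ideal[OF \<sigma> J(5)] by blast
    show "f \<otimes> g \<in> I \<inter> J"
      if "f \<in> d_ideal n S \<sigma> I \<inter> d_ideal n S \<sigma> J" "g \<in> d_ideal n S \<sigma> I \<inter> d_ideal n S \<sigma> J" for f g
      using that I(7)[of f g] J(7)[of f g] by blast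
  qed
qed

lemma homogeneous_part_mult:
  "homogeneous_part d (series_mult f g) =
    (\<lambda>m. \<Sum>e\<le>d. series_mult (homogeneous_part e f) (homogeneous_part (d - e) g) m)"
proof
  fix m :: expo
  let ?T = "{x. fst x + snd x = m}"
  have "(\<Sum>e\<le>d. series_mult (homogeneous_part e f) (homogeneous_part (d - e) g) m) =
      (\<Sum>x\<in>?T. \<Sum>e\<le>d. homogeneous_part e f (fst x) * homogeneous_part (d - e) g (snd x))"
    unfolding series_mult_alt by (rule sum.swap)
  also have "\<dots> = (\<Sum>x\<in>?T. if expo_degree m = d then f (fst x) * g (snd x) else 0)"
  proof (rule sum.cong[OF refl])
    fix x assume "x \<in> ?T"
    then have deg: "expo_degree m = expo_degree (fst x) + expo_degree (snd x)"
      by (auto simp: expo_degree_add)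
    \<comment> \<open>Only the summand with \<open>e = expo_degree (fst x)\<close> can be
      nonzero.\<close>
    have "(\<Sum>e\<le>d. homogeneous_part e f (fst x) * homogeneous_part (d - e) g (snd x)) =
        (\<Sum>e\<le>d. if expo_degree (fst x) = e then
          (if expo_degree m = d then f (fst x) * g (snd x) else 0) else 0)"
      by (rule sum.cong[OF refl]) (auto simp: homogeneous_part_def deg)
    also have "\<dots> = (if expo_degree m = d then f (fst x) * g (snd x) else 0)"
      by (simp add: sum.delta' deg)
    finally show "(\<Sum>e\<le>d. homogeneous_part e f (fst x) * homogeneous_part (d - e) g (snd x)) = \<dots>" .
  qed
  also have "\<dots> = homogeneous_part d (series_mult f g) m"
    by (simp add: homogeneous_part_def series_mult_alt)
  finally show "homogeneous_part d (series_mult f g) m =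
      (\<Sum>e\<le>d. series_mult (homogeneous_part e f) (homogeneous_part (d - e) g) m)" ..
qed

lemma homogeneous_part_add: "homogeneous_part d (f \<oplus> g) = homogeneous_part d f \<oplus> homogeneous_part d g"
  by (auto simp: ops homogeneous_part_def)

lemma sum_in_ideal:
  assumes "ideal I S" "\<And>e. e \<le> (d::nat) \<Longrightarrow> h e \<in> I"
  shows "(\<lambda>m. \<Sum>e\<le>d. h e m) \<in> I"
  using assms(2)
proof (induction d)
  case 0
  then show ?case by simp
next
  case (Suc d)
  interpret I: ideal I S by (rule assms(1))
  have "(\<lambda>m. \<Sum>e\<le>d. h e m) \<oplus> h (Suc d) \<in> I" using Suc by (intro I.a_closed) auto
  then show ?case by (simp add: ops)
qed

lemma graded_ideal_prod:
  assumes "ideal I S" "ideal J S" "graded I" "graded J"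
  shows "graded (I \<cdot> J)"
  unfolding graded_def
proof (intro ballI allI)
  fix h d assume "h \<in> I \<cdot> J"
  then show "homogeneous_part d h \<in> I \<cdot> J"
  proof induction
    case (prod f g)
    have "homogeneous_part e f \<otimes> homogeneous_part (d - e) g \<in> I \<cdot> J" for e
      using prod assms(3,4) by (intro ideal_prod.prod) (auto simp: graded_def)
    then show ?case
      using sum_in_ideal[OF ideal_prod_is_ideal[OF assms(1,2)]] by (simp add: ops homogeneous_part_mult)
  next
    case (sum f g)
    then show ?case unfolding homogeneous_part_add by (intro ideal_prod.sum)
  qed
qed

lemma d_golod_ideal_prod:
  assumes \<sigma>: "\<sigma> permutes {1..n}" and "d_golod n S \<sigma> I" "d_golod n S \<sigma> J"
  shows "d_golod n S \<sigma> (I \<cdot> J)"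
proof -
  note I = d_golodD[OF assms(2) \<sigma>] and J = d_golodD[OF assms(3) \<sigma>]
  let ?A = "d_ideal n S \<sigma> I" and ?B = "d_ideal n S \<sigma> J"
  show ?thesis
  proof (rule d_golodI[OF _ _ _ \<sigma>])
    show "ideal (I \<cdot> J) S" by (rule ideal_prod_is_ideal[OF I(1) J(1)])
    show "I \<cdot> J \<noteq> carrier S" using ideal_prod_inter[OF I(1) J(1)] I(2,5) by blast
    show "graded (I \<cdot> J)" if "S = polynomial_ring n"
      by (rule graded_ideal_prod[OF I(1) J(1) I(3)[OF that] J(3)[OF that]])
    show AB: "ideal (?A \<cdot> ?B) S" by (rule ideal_prod_is_ideal[OF I(6) J(6)])
    show "d_perm \<sigma> i f \<in> ?A \<cdot> ?B" if "i \<in> {1..n}" "f \<in> I \<cdot> J" for i f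
      by (rule d_perm_ideal_prod[OF \<sigma> I(1,4) J(1,4) that])
    note carr = ideal.Icarr[OF I(6)] ideal.Icarr[OF J(6)] ideal.Icarr[OF AB]
    fix f g assume f: "f \<in> ?A \<cdot> ?B" and g: "g \<in> ?A \<cdot> ?B"
    show "f \<otimes> g \<in> I \<cdot> J"
      using f
    proof induction
      case (prod a b)
      show ?case
        using g
      proof induction
        case (prod c d)
        \<comment> \<open>Regrouping (ab)(cd) as (ac)(bd) separates the factors from
          \<open>?A\<close>, whose product lies in \<open>I\<close>, from those of
          \<open>?B\<close>, whose product lies in \<open>J\<close>.\<close>
        have "(a \<otimes> c) \<otimes> (b \<otimes> d) \<in> I \<cdot> J"
          using \<open>a \<in> ?A\<close> \<open>b \<in> ?B\<close> prod by (intro ideal_prod.prod I(7) J(7))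
        then show ?case
          using carr \<open>a \<in> ?A\<close> \<open>b \<in> ?B\<close> prod by (simp add: m_ac)
      next
        case (sum c d)
        then show ?case
          using carr \<open>a \<in> ?A\<close> \<open>b \<in> ?B\<close> by (simp add: r_distr ideal_prod.sum)
      qed
    next
      case (sum a b)
      then show ?case using carr g by (simp add: l_distr ideal_prod.sum)
    qed
  qed
qed

lemma set_addI: "f \<in> I \<Longrightarrow> g \<in> J \<Longrightarrow> f \<oplus> g \<in> I <+>\<^bsub>S\<^esub> J"
  unfolding set_add_def' by blast

lemma set_addE:
  assumes "h \<in> I <+>\<^bsub>S\<^esub> J"
  obtains f g where "f \<in> I" "g \<in> J" "h = f \<oplus> g"
  using assms unfolding set_add_def' by blast

lemma d_golod_add:
  assumes \<sigma>: "\<sigma> permutes {1..n}" and "d_golod n S \<sigma> I" "d_golod n S \<sigma> J"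
    and mixed: "d_ideal n S \<sigma> I \<cdot> d_ideal n S \<sigma> J \<subseteq> I <+>\<^bsub>S\<^esub> J"
  shows "d_golod n S \<sigma> (I <+>\<^bsub>S\<^esub> J)"
proof -
  note I = d_golodD[OF assms(2) \<sigma>] and J = d_golodD[OF assms(3) \<sigma>]
  let ?A = "d_ideal n S \<sigma> I" and ?B = "d_ideal n S \<sigma> J"
  have IJ: "ideal (I <+>\<^bsub>S\<^esub> J) S" by (rule add_ideals[OF I(1) J(1)])
  interpret IJ: ideal "I <+>\<^bsub>S\<^esub> J" S by (rule IJ)
  have "\<zero> \<in> I" "\<zero> \<in> J"
    using I(1) J(1) additive_subgroup.zero_closed ideal.axioms(1) by blast+
  then have sub: "f \<in> I <+>\<^bsub>S\<^esub> J" if "f \<in> I \<or> f \<in> J" for f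
    using that set_addI[of f I \<zero> J] set_addI[of \<zero> I f J] I(5) J(5) by auto
  show ?thesis
  proof (rule d_golodI[OF IJ _ _ \<sigma>])
    show "I <+>\<^bsub>S\<^esub> J \<noteq> carrier S"
    proof
      assume "I <+>\<^bsub>S\<^esub> J = carrier S"
      \<comment> \<open>Properness of a sum does not follow from properness of the summands; it
        holds here because both ideals have vanishing constant terms.\<close>
      then have "\<one> \<in> I <+>\<^bsub>S\<^esub> J" by simp
      then obtain f g where fg: "f \<in> I" "g \<in> J" "\<one> = f \<oplus> g" by (rule set_addE)
      have "f 0 = 0" "g 0 = 0" using fg(1,2) I(4) J(4) by blast+
      then have "\<one> 0 = (0::'k)" unfolding fg(3) by (simp add: ops)
      then show False by (simp add: ops monomial_def)
    qed
    show "graded (I <+>\<^bsub>S\<^esub> J)" if "S = polynomial_ring n"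
      unfolding graded_def
    proof (intro ballI allI)
      fix h d assume "h \<in> I <+>\<^bsub>S\<^esub> J"
      then obtain f g where fg: "f \<in> I" "g \<in> J" "h = f \<oplus> g" by (rule set_addE)
      have "homogeneous_part d f \<in> I" "homogeneous_part d g \<in> J"
        using fg(1,2) I(3)[OF that] J(3)[OF that] unfolding graded_def by blast+
      then show "homogeneous_part d h \<in> I <+>\<^bsub>S\<^esub> J"
        unfolding fg(3) homogeneous_part_add by (rule set_addI)
    qed
    show "ideal (?A <+>\<^bsub>S\<^esub> ?B) S" by (rule add_ideals[OF I(6) J(6)])
    show "d_perm \<sigma> i h \<in> ?A <+>\<^bsub>S\<^esub> ?B" if i: "i \<in> {1..n}" and h: "h \<in> I <+>\<^bsub>S\<^esub> J" for i h
    proof -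
      from h obtain f g where "f \<in> I" "g \<in> J" "h = f \<oplus> g" by (rule set_addE)
      then show ?thesis
        using i by (simp add: d_perm_add set_addI d_perm_in_d_ideal[OF \<sigma> I(5)] d_perm_in_d_ideal[OF \<sigma> J(5)])
    qed
    fix h h' assume h: "h \<in> ?A <+>\<^bsub>S\<^esub> ?B" and h': "h' \<in> ?A <+>\<^bsub>S\<^esub> ?B"
    from h obtain a b where ab: "a \<in> ?A" "b \<in> ?B" "h = a \<oplus> b" by (rule set_addE)
    from h' obtain c d where cd: "c \<in> ?A" "d \<in> ?B" "h' = c \<oplus> d" by (rule set_addE)
    have carr: "a \<in> carrier S" "b \<in> carrier S" "c \<in> carrier S" "d \<in> carrier S"
      using ab cd ideal.Icarr[OF I(6)] ideal.Icarr[OF J(6)] by auto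
    \<comment> \<open>In the expansion of (a + b)(c + d), the products \<open>a \<otimes> c\<close>
      and \<open>b \<otimes> d\<close> are covered by the Golod property of \<open>I\<close> and
      \<open>J\<close>, the other two by \<open>mixed\<close>.\<close>
    have "a \<otimes> c \<in> I <+>\<^bsub>S\<^esub> J" "b \<otimes> d \<in> I <+>\<^bsub>S\<^esub> J"
      using I(7)[OF ab(1) cd(1)] J(7)[OF ab(2) cd(2)] sub by blast+
    moreover have "a \<otimes> d \<in> I <+>\<^bsub>S\<^esub> J" "c \<otimes> b \<in> I <+>\<^bsub>S\<^esub> J"
      using mixed ideal_prod.prod[OF ab(1) cd(2), of S] ideal_prod.prod[OF cd(1) ab(2), of S] by blast+
    ultimately have "(a \<otimes> c \<oplus> c \<otimes> b) \<oplus> (a \<otimes> d \<oplus> b \<otimes> d) \<in> I <+>\<^bsub>S\<^esub> J" by simp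
    also have "(a \<otimes> c \<oplus> c \<otimes> b) \<oplus> (a \<otimes> d \<oplus> b \<otimes> d) = h \<otimes> h'"
      using carr by (simp add: ab(3) cd(3) l_distr r_distr m_comm[of b c])
    finally show "h \<otimes> h' \<in> I <+>\<^bsub>S\<^esub> J" .
  qed
qed

section \<open>Products of nested monomial ideals\<close>

lemma d_golod_mspan_prod:
  assumes M: "upset n M" and N: "upset n N" and MN: "M \<subseteq> N" and \<sigma>: "\<sigma> permutes {1..n}"
    and golod: "d_golod n S \<sigma> (mspan M)"
  shows "d_golod n S \<sigma> (mspan M \<cdot> mspan N)"
proof -
  have 0: "0 \<notin> M" and D: "\<And>a b. a \<in> d_expos n \<sigma> M \<Longrightarrow> b \<in> d_expos n \<sigma> M \<Longrightarrow> a + b \<in> M"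
    using golod unfolding d_golod_mspan_iff[OF M \<sigma>] by blast+
  have U: "upset n (M + N)" by (rule upset_set_plus[OF upset_subset[OF M] N])
  have "0 \<notin> M + N" using 0 by (auto elim!: set_plus_elim)
  \<comment> \<open>The removed variable comes from \<open>u\<close> or from \<open>v\<close>. In
    the first case it is also the first variable of \<open>u\<close>, as the quotient of
    \<open>u\<close> divides \<open>m\<close>; in the second case \<open>u\<close> survives and
    keeps \<open>m\<close> in \<open>M\<close>.\<close>
  moreover have cases: "m \<in> M \<or> (\<exists>a\<in>d_expos n \<sigma> M. \<exists>b\<in>N. m = a + b)" if m: "m \<in> d_expos n \<sigma> (M + N)" for m
  proof -
    from m obtain i where i: "i \<in> {1..n}" "\<forall>k\<in>Poly_Mapping.keys m. i \<le> inv_into UNIV \<sigma> k"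
      "m + xvec (\<sigma> i) \<in> M + N"
      unfolding d_expos_def by blast
    from i(3) obtain u v where uv: "m + xvec (\<sigma> i) = u + v" "u \<in> M" "v \<in> N" by (rule set_plus_elim)
    have "\<sigma> i \<in> Poly_Mapping.keys (m + xvec (\<sigma> i))" by (simp add: keys_add_nat xvec_def)
    then consider "\<sigma> i \<in> Poly_Mapping.keys u" | "\<sigma> i \<in> Poly_Mapping.keys v"
      unfolding uv(1) keys_add_nat by blast
    then show ?thesis
    proof cases
      case 1
      then obtain a where a: "u = xvec (\<sigma> i) + a" by (rule keys_xvec_decomp)
      have "m + xvec (\<sigma> i) = (a + v) + xvec (\<sigma> i)" using uv(1) by (simp only: a ac_simps)
      then have m: "m = a + v" by (simp only: add_right_cancel)
      have "a + xvec (\<sigma> i) \<in> M" using uv(2) by (simp only: a add.commute)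
      then have "a \<in> d_expos n \<sigma> M"
        unfolding d_expos_def using i(1,2) by (auto simp: m keys_add_nat)
      then show ?thesis using m uv(3) by blast
    next
      case 2
      then obtain b where b: "v = xvec (\<sigma> i) + b" by (rule keys_xvec_decomp)
      have "m + xvec (\<sigma> i) = (u + b) + xvec (\<sigma> i)" using uv(1) by (simp only: b ac_simps)
      then have "m = u + b" by (simp only: add_right_cancel)
      moreover have "b \<in> expos n" using upsetD[OF N uv(3)] by (simp add: b expos_add_iff)
      ultimately show ?thesis using upset_add[OF M uv(2)] by simp
    qed
  qed
  have inN: "m \<in> N" if "m \<in> d_expos n \<sigma> (M + N)" for m
    using cases[OF that] MN upset_add'[OF N] d_expos_subset[OF M] by blast
  have "x + y \<in> M + N" if x: "x \<in> d_expos n \<sigma> (M + N)" and y: "y \<in> d_expos n \<sigma> (M + N)" for x y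
  \<comment> \<open>If one exponent lies in \<open>M\<close>, the other lies in \<open>N\<close> by
    \<open>inN\<close>. Otherwise the two parts from \<open>d_expos n \<sigma> M\<close> add up to
    an element of \<open>M\<close> by the Golod hypothesis, and the rest stays in
    \<open>N\<close>.\<close>
  proof (cases "x \<in> M \<or> y \<in> M")
    case True
    then show ?thesis
      using inN[OF x] inN[OF y] set_plus_intro[of x M y N] set_plus_intro[of y M x N]
      by (auto simp: add.commute)
  next
    case False
    then obtain a b c d where x: "x = a + b" "a \<in> d_expos n \<sigma> M" "b \<in> N"
      and y: "y = c + d" "c \<in> d_expos n \<sigma> M" "d \<in> N"
      using cases[OF x] cases[OF y] by blast
    have "(a + c) + (b + d) \<in> M + N"
      using D[OF x(2) y(2)] upset_add[OF N x(3) upsetD[OF N y(3)]] by (rule set_plus_intro)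
    then show ?thesis by (simp add: x y ac_simps)
  qed
  ultimately show ?thesis
    unfolding ideal_prod_mspan[OF M N] d_golod_mspan_iff[OF U \<sigma>] by blast
qed

section \<open>Transfer from exponent sets to monomial ideals\<close>

lemma mspan_subset_iff: "M \<subseteq> expos n \<Longrightarrow> mspan M \<subseteq> mspan N \<longleftrightarrow> M \<subseteq> N"
  using mspan_mono[of M N] monomial_mspan_iff by blast

lemma monomial_ideal_variables: "monomial_ideal n S (variables_ideal n S)"
  unfolding monomial_ideal_def variables_ideal_def
  by (rule exI[of _ "xvec ` {1..n}"]) (auto simp: xvec_def image_image)

lemma strongly_d_golod_colon:
  assumes I: "monomial_ideal n S I" "strongly_d_golod n S I" and J: "monomial_ideal n S J"
    and eq: "colon S I J = colon S I (ideal_power S J 2)" and proper: "colon S I J \<noteq> carrier S"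
  shows "strongly_d_golod n S (colon S I J)"
proof -
  obtain M where M: "upset n M" "I = mspan M" using I(1) by (rule monomial_idealE)
  obtain N where N: "upset n N" "J = mspan N" using J by (rule monomial_idealE)
  have NN: "upset n (N + N)" by (rule upset_set_plus[OF upset_subset[OF N(1)] N(1)])
  have c: "colon S I J = mspan (colonset M N)"
    unfolding M(2) N(2) by (rule colon_mspan[OF M(1) N(1)])
  have "ideal_power S J 2 = mspan (N + N)"
    unfolding N(2) by (simp only: ideal_power_2[OF ideal_mspan[OF N(1)]] ideal_prod_mspan[OF N(1) N(1)])
  then have "mspan (colonset M (N + N)) \<subseteq> mspan (colonset M N)"
    using eq c by (simp add: M(2) colon_mspan[OF M(1) NN])
  then have "colonset M (N + N) \<subseteq> colonset M N"
    by (simp add: mspan_subset_iff[OF upset_subset[OF upset_colonset[OF M(1)]]])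
  moreover have "exchange n M"
    using I(2) unfolding M(2) strongly_d_golod_mspan_iff[OF M(1)] by blast
  ultimately have "exchange n (colonset M N)" by (intro exchange_colonset)
  then show ?thesis
    using proper upset_colonset[OF M(1)] unfolding c
    by (simp add: strongly_d_golod_mspan_iff mspan_eq_carrier_iff)
qed

lemma strongly_d_golod_powers:
  assumes I: "monomial_ideal n S I" and k: "2 \<le> k"
    and L: "L \<in> {ideal_power S I k, symbolic_power S I k,
      saturation S (ideal_power S I k) (variables_ideal n S)}" "L \<noteq> carrier S"
  shows "strongly_d_golod n S L"
proof -
  obtain M where M: "upset n M" "I = mspan M" using I by (rule monomial_idealE)
  obtain N where N: "upset n N" "variables_ideal n S = mspan N"
    using monomial_ideal_variables by (rule monomial_idealE)
  have pow: "ideal_power S I k = mspan (powset M k)"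
    unfolding M(2) by (rule ideal_power_mspan[OF M(1)])
  have up: "upset n (powset M k)" by (rule upset_powset[OF M(1)])
  have ex: "exchange n (powset M k)" by (rule exchange_powset[OF M(1) k])
  consider "L = mspan (powset M k)" | "L = symbolic_power S (mspan M) k"
    | "L = saturation S (mspan (powset M k)) (mspan N)"
    using L(1) pow M(2) N(2) by auto
  then show ?thesis
  proof cases
    case 1
    then show ?thesis
      using L(2) ex by (simp add: strongly_d_golod_mspan_iff[OF up] mspan_eq_carrier_iff[OF up])
  next
    case 2
    then show ?thesis using L(2) strongly_d_golod_symbolic_power[OF M(1) k] by simp
  next
    case 3
    then show ?thesis using L(2) strongly_d_golod_saturation[OF up ex N(1)] by simp
  qed
qed

lemma d_golod_monomial_prod:
  assumes "monomial_ideal n S I" "monomial_ideal n S J" and sub: "I \<subseteq> J" and \<sigma>: "\<sigma> permutes {1..n}"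
    and golod: "d_golod n S \<sigma> I"
  shows "d_golod n S \<sigma> (I \<cdot> J)"
proof -
  obtain M where M: "upset n M" "I = mspan M" using assms(1) by (rule monomial_idealE)
  obtain N where N: "upset n N" "J = mspan N" using assms(2) by (rule monomial_idealE)
  have "M \<subseteq> N" using sub unfolding M(2) N(2) mspan_subset_iff[OF upset_subset[OF M(1)]] .
  then show ?thesis
    using golod unfolding M(2) N(2) by (rule d_golod_mspan_prod[OF M(1) N(1) _ \<sigma>])
qed

end

theorem theorem3p1:
  fixes n :: nat and S :: "'k::field series ring" and I J :: "'k series set"
    and \<sigma> :: "nat \<Rightarrow> nat"
  assumes "S = power_series_ring n \<or> S = polynomial_ring n"
    and "ideal I S" and "ideal J S"
    and "S = polynomial_ring n \<Longrightarrow> graded I \<and> graded J"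
    and "\<sigma> permutes {1..n}"
  shows "(d_golod n S \<sigma> I \<and> d_golod n S \<sigma> J \<longrightarrow>
            d_golod n S \<sigma> (I \<inter> J) \<and> d_golod n S \<sigma> (I \<cdot>\<^bsub>S\<^esub> J))
       \<and> (d_golod n S \<sigma> I \<and> d_golod n S \<sigma> J \<and>
            d_ideal n S \<sigma> I \<cdot>\<^bsub>S\<^esub> d_ideal n S \<sigma> J \<subseteq> I <+>\<^bsub>S\<^esub> J \<longrightarrow>
            d_golod n S \<sigma> (I <+>\<^bsub>S\<^esub> J))
       \<and> (monomial_ideal n S I \<and> strongly_d_golod n S I \<and> monomial_ideal n S J \<and>
            colon S I J = colon S I (ideal_power S J 2) \<and> colon S I J \<noteq> carrier S \<longrightarrow>
            strongly_d_golod n S (colon S I J))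
       \<and> (monomial_ideal n S I \<longrightarrow>
            (\<forall>k\<ge>2. \<forall>L \<in> {ideal_power S I k, symbolic_power S I k,
                          saturation S (ideal_power S I k) (variables_ideal n S)}.
               L \<noteq> carrier S \<longrightarrow> strongly_d_golod n S L))
       \<and> (monomial_ideal n S I \<and> monomial_ideal n S J \<and> I \<subseteq> J \<and> d_golod n S \<sigma> I \<longrightarrow>
            d_golod n S \<sigma> (I \<cdot>\<^bsub>S\<^esub> J))"
proof -
  interpret series_ring n S by (rule series_ring.intro[OF assms(1)])
  show ?thesis
  proof (intro conjI impI allI ballI; (elim conjE)?)
    assume "d_golod n S \<sigma> I" "d_golod n S \<sigma> J"
    then show "d_golod n S \<sigma> (I \<inter> J)" "d_golod n S \<sigma> (I \<cdot>\<^bsub>S\<^esub> J)"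
      by (rule d_golod_Int[OF assms(5)], rule d_golod_ideal_prod[OF assms(5)])
  qed (rule d_golod_add[OF assms(5)] strongly_d_golod_colon strongly_d_golod_powers
      d_golod_monomial_prod[OF _ _ _ assms(5)]; assumption)+
qed

end
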